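(* Let $p\ge 3$, let $r,k_1,\dots,k_p$ be positive integers, and consider the $r$-class, $p$-feature latent-class model $\mathcal{M}(r;k_1,\dots,k_p)$. Suppose there exists a tripartition of the set $S=\{1,\dots,p\}$ into three disjoint nonempty subsets $S_1,S_2,S_3$ such that, with $\kappa_i=\prod_{j\in S_i}k_j$ for $i=1,2,3$, $$\min(r,\kappa_1)+\min(r,\kappa_2)+\min(r,\kappa_3)\ge 2r+2.$$ Then the parameters $(\boldsymbol\pi,(\mathbf p_{ij})_{1\le i\le r,\,1\le j\le p})$ of the model are generically identifiable, up to label swapping. Moreover, the statement remains valid when the mixing proportions $\{\pi_i\}_{1\le i\le r}$ are held fixed and positive: for every fixed $\boldsymbol\pi$ with positive entries summing to $1$, the parameters $(\mathbf p_{ij})$ of the submodel with these mixing proportions are generically identifiable, up to label swapping.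
   Context: Model $\mathcal{M}(r;k_1,\dots,k_p)$: a latent variable $Z$ takes values in $\{1,\dots,r\}$ ($r$ known) with $\mathbb P(Z=i)=\pi_i$, where $\boldsymbol\pi=(\pi_1,\dots,\pi_r)$ has positive entries summing to $1$. The observed variables $X_1,\dots,X_p$, with $X_j\in\{1,\dots,k_j\}$, are independent conditional on $Z$, with $\mathbb P(X_j=l\mid Z=i)=\mathbf p_{ij}(l)$, where $\mathbf p_{ij}\in[0,1]^{k_j}$ and $\sum_l\mathbf p_{ij}(l)=1$. The distribution of $(X_1,\dots,X_p)$ is the array $\mathbb P=\sum_{i=1}^r\pi_i\,\mathbf p_{i1}\otimes\cdots\otimes\mathbf p_{ip}$, whose $(l_1,\dots,l_p)$-entry is $\sum_i\pi_i\prod_j\mathbf p_{ij}(l_j)$. The parameter space $\Theta$ is the set of all $(\boldsymbol\pi,(\mathbf p_{ij}))$, identified (by dropping one coordinate from each probability vector) with a full-dimensional subset of $\mathbb R^L$, $L=(r-1)+r\sum_j(k_j-1)$. When $\boldsymbol\pi$ is fixed, the parameter space is the set of all $(\mathbf p_{ij})$, identified with a full-dimensional subset of $\mathbb R^{r\sum_j(k_j-1)}$. Label swapping: two parameters $(\boldsymbol\pi,(\mathbf p_{ij}))$ and $(\boldsymbol\pi',(\mathbf p'_{ij}))$ are equal up to label swapping if there is a permutation $\sigma$ of $\{1,\dots,r\}$ with $\pi'_i=\pi_{\sigma(i)}$ and $\mathbf p'_{ij}=\mathbf p_{\sigma(i)j}$ for all $i,j$. Generic identifiability up to label swapping: there is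 a proper algebraic subvariety $V$ of the ambient Euclidean space (the common zero set of finitely many polynomials, not all identically zero) such that for every parameter $\theta$ outside $V$, every parameter $\theta'$ in the parameter space giving the same distribution of $(X_1,\dots,X_p)$ equals $\theta$ up to label swapping. *)

theory Defs
  imports "HOL-Library.FuncSet" "HOL-Combinatorics.Permutations" Complex_Main
begin

text \<open>Affine space with coordinates indexed by \<open>I\<close> is the set \<open>I \<rightarrow>\<^sub>E UNIV\<close> of real-valued functions
  that are \<open>undefined\<close> off \<open>I\<close>. Polynomials are taken as polynomial functions, as in
  \<open>real_polynomial_function\<close> of HOL-Analysis, which is not applicable here because the dimension
  depends on term-level parameters. Over the reals, a polynomial is zero iff its function is.\<close>

inductive_set poly_funs :: "'i set \<Rightarrow> (('i \<Rightarrow> real) \<Rightarrow> real) set" for I where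
  const: "(\<lambda>_. c) \<in> poly_funs I"
| var: "i \<in> I \<Longrightarrow> (\<lambda>x. x i) \<in> poly_funs I"
| add: "f \<in> poly_funs I \<Longrightarrow> g \<in> poly_funs I \<Longrightarrow> (\<lambda>x. f x + g x) \<in> poly_funs I"
| mult: "f \<in> poly_funs I \<Longrightarrow> g \<in> poly_funs I \<Longrightarrow> (\<lambda>x. f x * g x) \<in> poly_funs I"

definition proper_subvariety :: "'i set \<Rightarrow> ('i \<Rightarrow> real) set \<Rightarrow> bool" where
  "proper_subvariety I V \<longleftrightarrow>
     (\<exists>F. finite F \<and> F \<subseteq> poly_funs I \<and>
          (\<exists>f\<in>F. \<exists>x \<in> I \<rightarrow>\<^sub>E UNIV. f x \<noteq> 0) \<and>
          V = {x \<in> I \<rightarrow>\<^sub>E UNIV. \<forall>f\<in>F. f x = 0})"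

text \<open>Here \<open>\<Theta>\<close> is a parameter space, identified by \<open>c\<close> with a subset of \<open>I \<rightarrow>\<^sub>E UNIV\<close>; \<open>D\<close> maps a
  parameter to its distribution, and \<open>eqv\<close> is the relation up to which parameters are identified.\<close>

definition generically_identifiable ::
  "'i set \<Rightarrow> 'a set \<Rightarrow> ('a \<Rightarrow> 'i \<Rightarrow> real) \<Rightarrow> ('a \<Rightarrow> 'd) \<Rightarrow> ('a \<Rightarrow> 'a \<Rightarrow> bool) \<Rightarrow> bool" where
  "generically_identifiable I \<Theta> c D eqv \<longleftrightarrow>
     (\<exists>V. proper_subvariety I V \<and>
          (\<forall>\<theta>\<in>\<Theta>. c \<theta> \<notin> V \<longrightarrow> (\<forall>\<theta>'\<in>\<Theta>. D \<theta>' = D \<theta> \<longrightarrow> eqv \<theta> \<theta>')))"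

text \<open>A parameter is a pair \<open>(\<pi>, q)\<close>, where \<open>q i j l\<close> is the probability that feature \<open>j\<close> takes the
  value \<open>l\<close> given class \<open>i\<close>. Only the values at \<open>i \<in> {1..r}\<close>, \<open>j \<in> {1..p}\<close>, \<open>l \<in> {1..k j}\<close> are
  meaningful; every notion below ignores the others.\<close>

type_synonym cond_probs = "nat \<Rightarrow> nat \<Rightarrow> nat \<Rightarrow> real"
type_synonym param = "(nat \<Rightarrow> real) \<times> cond_probs"

definition mixing_props :: "nat \<Rightarrow> (nat \<Rightarrow> real) set" where
  "mixing_props r = {\<pi>. (\<forall>i\<in>{1..r}. 0 < \<pi> i) \<and> (\<Sum>i=1..r. \<pi> i) = 1}"

definition cond_space :: "nat \<Rightarrow> nat \<Rightarrow> (nat \<Rightarrow> nat) \<Rightarrow> cond_probs set" where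
  "cond_space r p k =
     {q. \<forall>i\<in>{1..r}. \<forall>j\<in>{1..p}. (\<forall>l\<in>{1..k j}. q i j l \<in> {0..1}) \<and> (\<Sum>l=1..k j. q i j l) = 1}"

definition param_space :: "nat \<Rightarrow> nat \<Rightarrow> (nat \<Rightarrow> nat) \<Rightarrow> param set" where
  "param_space r p k = mixing_props r \<times> cond_space r p k"

definition distr_array :: "nat \<Rightarrow> nat \<Rightarrow> (nat \<Rightarrow> nat) \<Rightarrow> param \<Rightarrow> (nat \<Rightarrow> nat) \<Rightarrow> real" where
  "distr_array r p k = (\<lambda>(\<pi>, q).
     \<lambda>l \<in> (\<Pi>\<^sub>E j\<in>{1..p}. {1..k j}). \<Sum>i=1..r. \<pi> i * (\<Prod>j=1..p. q i j (l j)))"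

definition eq_up_to_label_swapping :: "nat \<Rightarrow> nat \<Rightarrow> (nat \<Rightarrow> nat) \<Rightarrow> param \<Rightarrow> param \<Rightarrow> bool" where
  "eq_up_to_label_swapping r p k = (\<lambda>(\<pi>, q) (\<pi>', q').
     \<exists>\<sigma>. \<sigma> permutes {1..r} \<and>
       (\<forall>i\<in>{1..r}. \<pi>' i = \<pi> (\<sigma> i) \<and> (\<forall>j\<in>{1..p}. \<forall>l\<in>{1..k j}. q' i j l = q (\<sigma> i) j l)))"

text \<open>The free coordinates of a parameter: the last entry of each probability vector is dropped, so
  there are \<open>r * (\<Sum>j=1..p. (k j - 1))\<close> coordinates \<open>Cond i j l\<close> and \<open>r - 1\<close> coordinates \<open>Mix i\<close>.\<close>

datatype coord = Mix nat | Cond nat nat nat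

definition cond_coords :: "nat \<Rightarrow> nat \<Rightarrow> (nat \<Rightarrow> nat) \<Rightarrow> coord set" where
  "cond_coords r p k = {Cond i j l |i j l. i \<in> {1..r} \<and> j \<in> {1..p} \<and> l \<in> {1..<k j}}"

definition all_coords :: "nat \<Rightarrow> nat \<Rightarrow> (nat \<Rightarrow> nat) \<Rightarrow> coord set" where
  "all_coords r p k = Mix ` {1..<r} \<union> cond_coords r p k"

definition coord_vec :: "coord set \<Rightarrow> param \<Rightarrow> coord \<Rightarrow> real" where
  "coord_vec I = (\<lambda>(\<pi>, q). \<lambda>c\<in>I. case c of Mix i \<Rightarrow> \<pi> i | Cond i j l \<Rightarrow> q i j l)"

definition gen_ident_model :: "nat \<Rightarrow> nat \<Rightarrow> (nat \<Rightarrow> nat) \<Rightarrow> bool" where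
  "gen_ident_model r p k \<longleftrightarrow>
     generically_identifiable (all_coords r p k) (param_space r p k)
       (coord_vec (all_coords r p k)) (distr_array r p k) (eq_up_to_label_swapping r p k)"

text \<open>In the submodel with fixed \<open>\<pi>\<close>, label swapping is still that of the full parameters
  \<open>(\<pi>, q)\<close> and \<open>(\<pi>, q')\<close>, so the permutation must also preserve \<open>\<pi>\<close>.\<close>

definition gen_ident_fixed_mixing :: "nat \<Rightarrow> nat \<Rightarrow> (nat \<Rightarrow> nat) \<Rightarrow> (nat \<Rightarrow> real) \<Rightarrow> bool" where
  "gen_ident_fixed_mixing r p k \<pi> \<longleftrightarrow>
     generically_identifiable (cond_coords r p k) (cond_space r p k)
       (\<lambda>q. coord_vec (cond_coords r p k) (\<pi>, q)) (\<lambda>q. distr_array r p k (\<pi>, q))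
       (\<lambda>q q'. eq_up_to_label_swapping r p k (\<pi>, q) (\<pi>, q'))"

end

theory Submission
  imports Defs "HOL-Library.Function_Algebras" "HOL-Computational_Algebra.Polynomial"
begin

text \<open>The features in each block \<open>S\<^sub>s\<close> of the tripartition form one feature with \<open>\<kappa>\<^sub>s\<close> values, so the
  distribution becomes a three-way array that is a sum of \<open>r\<close> rank-one arrays. Kruskal's theorem says
  that such a decomposition is unique up to order if the Kruskal ranks of the three families of
  factors add up to at least \<open>2 * r + 2\<close>. What remains is that, for generic parameters, the family of
  the \<open>r\<close> joint distributions of the block \<open>S\<^sub>s\<close> has Kruskal rank at least \<open>min r \<kappa>\<^sub>s\<close>, and that the
  parameters of a class can be read off its rank-one array by summing out features
  (\<open>class_recovery\<close>).

  Kruskal's theorem (\<open>kruskal_uniqueness\<close>) follows the approach of Lovitz and Petrov. The difference of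
  two decompositions is a vanishing sum of product tensors. In a vanishing sum of \<open>t\<close> triple products
  without vanishing subsums, the dimensions of the spans of the three factors add up to at most
  \<open>t + 1\<close> (\<open>minimal_zero_sum_spanning\<close>). This rests on a lower bound for the rank of a family of
  product tensors that does not split (\<open>tensor_family_span_rank\<close>), which in turn is an iterated use of
  Sylvester's inequality (\<open>relation_split\<close>). Large Kruskal ranks therefore force some
  vanishing subsum to consist of one term of each decomposition; these cancel, and the argument
  repeats.

  Genericity comes from one point. Independence of given rows is implied by the nonvanishing of a
  polynomial that is nonzero at any prescribed point where the rows are independent
  (\<open>indep_family_open_condition\<close>). It therefore suffices to find a parameter at which the Kruskal ranks
  are as large as claimed; powers of the class number, arranged so that the joint distribution of a
  block is a row of a Vandermonde matrix, provide one (\<open>power_cond_kruskal_rank\<close>).\<close>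

section \<open>Independent families and spans\<close>

text \<open>Arrays are functions on their index sets. As a \<open>real_vector\<close> instance, such a function space
  inherits the dimension theory of spans.\<close>

instantiation "fun" :: (type, real_vector) real_vector
begin
definition scaleR_fun :: "real \<Rightarrow> ('a \<Rightarrow> 'b) \<Rightarrow> 'a \<Rightarrow> 'b" where
  "scaleR_fun c f = (\<lambda>x. c *\<^sub>R f x)"
instance
  by standard (simp_all add: scaleR_fun_def fun_eq_iff scaleR_add_right scaleR_add_left)
end

lemma scaleR_fun_apply [simp]: "(c *\<^sub>R f) x = c *\<^sub>R f x"
  by (simp add: scaleR_fun_def)

lemma sum_fun_apply: "(\<Sum>a\<in>A. f a) x = (\<Sum>a\<in>A. f a x)"
  by (induction A rule: infinite_finite_induct) auto

text \<open>Independence belongs to the indexed family, not to its range: two indices with the same vector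
  make the family dependent.\<close>

definition indep_family :: "('i \<Rightarrow> 'v::real_vector) \<Rightarrow> 'i set \<Rightarrow> bool" where
  "indep_family x A \<longleftrightarrow> (\<forall>c. (\<Sum>a\<in>A. c a *\<^sub>R x a) = 0 \<longrightarrow> (\<forall>a\<in>A. c a = 0))"

lemma indep_familyD:
  "indep_family x A \<Longrightarrow> (\<Sum>a\<in>A. c a *\<^sub>R x a) = 0 \<Longrightarrow> a \<in> A \<Longrightarrow> c a = 0"
  unfolding indep_family_def by blast

lemma span_image_iff:
  assumes "finite A"
  shows "v \<in> span (x ` A) \<longleftrightarrow> (\<exists>c. v = (\<Sum>a\<in>A. c a *\<^sub>R x a))"
  using assms
proof (induction A arbitrary: v)
  case empty
  then show ?case by simp
next
  case (insert a A)
  have "v \<in> span (x ` insert a A) \<longleftrightarrow> (\<exists>k. v - k *\<^sub>R x a \<in> span (x ` A))"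
    by (simp add: span_breakdown_eq)
  also have "\<dots> \<longleftrightarrow> (\<exists>k c. v - k *\<^sub>R x a = (\<Sum>b\<in>A. c b *\<^sub>R x b))"
    using insert.IH by simp
  also have "\<dots> \<longleftrightarrow> (\<exists>c. v = (\<Sum>b\<in>insert a A. c b *\<^sub>R x b))"
  proof
    assume "\<exists>k c. v - k *\<^sub>R x a = (\<Sum>b\<in>A. c b *\<^sub>R x b)"
    then obtain k c where kc: "v - k *\<^sub>R x a = (\<Sum>b\<in>A. c b *\<^sub>R x b)" by blast
    have "(\<Sum>b\<in>A. (c(a := k)) b *\<^sub>R x b) = (\<Sum>b\<in>A. c b *\<^sub>R x b)"
      by (rule sum.cong) (use insert in auto)
    then have "v = (\<Sum>b\<in>insert a A. (c(a := k)) b *\<^sub>R x b)"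
      using insert kc by (simp add: algebra_simps)
    then show "\<exists>c. v = (\<Sum>b\<in>insert a A. c b *\<^sub>R x b)" by blast
  next
    assume "\<exists>c. v = (\<Sum>b\<in>insert a A. c b *\<^sub>R x b)"
    then obtain c where "v = (\<Sum>b\<in>insert a A. c b *\<^sub>R x b)" by blast
    then have "v - c a *\<^sub>R x a = (\<Sum>b\<in>A. c b *\<^sub>R x b)" using insert by simp
    then show "\<exists>k c. v - k *\<^sub>R x a = (\<Sum>b\<in>A. c b *\<^sub>R x b)" by blast
  qed
  finally show ?case .
qed

lemma in_span_solve:
  assumes "finite A" "a \<in> A" "c a \<noteq> 0" "w = (\<Sum>b\<in>A. c b *\<^sub>R x b)"
  shows "x a \<in> span (insert w (x ` (A - {a})))"
proof -
  have "w = c a *\<^sub>R x a + (\<Sum>b\<in>A - {a}. c b *\<^sub>R x b)"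
    using assms by (simp add: sum.remove)
  then have "x a = (1 / c a) *\<^sub>R (w - (\<Sum>b\<in>A - {a}. c b *\<^sub>R x b))"
    using assms(3) by simp
  moreover have "w - (\<Sum>b\<in>A - {a}. c b *\<^sub>R x b) \<in> span (insert w (x ` (A - {a})))"
    by (intro span_diff span_sum span_scale) (auto intro: span_base)
  ultimately show ?thesis by (simp only: span_scale)
qed

lemma indep_family_card_le:
  assumes "finite A" "indep_family x A" "finite B" "x ` A \<subseteq> span B"
  shows "card A \<le> card B"
proof -
  have inj: "inj_on x A"
  proof (rule inj_onI, rule ccontr)
    fix a b assume ab: "a \<in> A" "b \<in> A" "x a = x b" "a \<noteq> b"
    define c where "c i = (if i = a then 1 else if i = b then -1 else (0::real))" for i
    have "(\<Sum>i\<in>A. c i *\<^sub>R x i) = (\<Sum>i\<in>{a, b}. c i *\<^sub>R x i)"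
      by (rule sum.mono_neutral_right) (use assms ab in \<open>auto simp: c_def\<close>)
    also have "\<dots> = 0" using ab by (simp add: c_def)
    finally show False
      using indep_familyD[OF assms(2), of c a] ab by (simp add: c_def)
  qed
  have "independent (x ` A)"
  proof (rule independent_if_scalars_zero)
    fix f v assume "(\<Sum>v\<in>x ` A. f v *\<^sub>R v) = 0" "v \<in> x ` A"
    then show "f v = 0"
      using indep_familyD[OF assms(2), of "f \<circ> x"] by (auto simp: sum.reindex[OF inj])
  qed (use assms in simp)
  then have "card (x ` A) \<le> card B"
    using independent_span_bound assms by blast
  then show ?thesis using inj by (simp add: card_image)
qed

text \<open>This is Sylvester's rank inequality for a vanishing sum of matrices \<open>x a \<otimes> y a\<close>, taken modulo a
  subspace \<open>U\<close>: the \<open>x a\<close> span at most \<open>card E\<close> dimensions modulo \<open>U\<close>, the \<open>y a\<close> at most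
  \<open>card D - card E\<close>. For a minimal \<open>E\<close> generating all \<open>x a\<close> modulo \<open>U\<close>, the \<open>x b\<close> with \<open>b \<in> E\<close> are
  independent modulo \<open>U\<close>, so the coefficient of each of them in the relation vanishes; that
  equation writes \<open>y b\<close> in terms of the \<open>y a\<close> with \<open>a \<notin> E\<close>.\<close>

lemma relation_split:
  fixes x :: "'i \<Rightarrow> 'v::real_vector" and y :: "'i \<Rightarrow> 'q \<Rightarrow> real"
  assumes fin: "finite D" and U: "subspace U"
    and rel: "\<And>q. (\<Sum>a\<in>D. y a q *\<^sub>R x a) \<in> U"
  obtains E where "E \<subseteq> D" "x ` D \<subseteq> span (U \<union> x ` E)" "y ` D \<subseteq> span (y ` (D - E))"
proof -
  let ?ok = "\<lambda>E. E \<subseteq> D \<and> x ` D \<subseteq> span (U \<union> x ` E)"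
  have "?ok D" by (auto intro: span_base)
  then obtain E where E: "?ok E" and min: "\<And>E'. ?ok E' \<Longrightarrow> card E \<le> card E'"
    using ex_has_least_nat[of ?ok D card] by blast
  have finE: "finite E" using E fin finite_subset by blast
  have indep: "\<beta> b = 0" if b: "b \<in> E" and \<beta>: "(\<Sum>a\<in>E. \<beta> a *\<^sub>R x a) \<in> U" for \<beta> b
  proof (rule ccontr)
    assume "\<beta> b \<noteq> 0"
    then have "x b \<in> span (insert (\<Sum>a\<in>E. \<beta> a *\<^sub>R x a) (x ` (E - {b})))"
      by (intro in_span_solve[OF finE b _ refl])
    also have "\<dots> \<subseteq> span (U \<union> x ` (E - {b}))"
      by (rule span_mono) (use \<beta> in auto)
    finally have "U \<union> x ` E \<subseteq> span (U \<union> x ` (E - {b}))"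
      by (auto intro: span_base) 
    then have "span (U \<union> x ` E) \<subseteq> span (U \<union> x ` (E - {b}))"
      by (simp add: span_minimal)
    then have "?ok (E - {b})" using E by blast
    then have "card E \<le> card (E - {b})" using min by blast
    then show False using finE b by (metis card_Diff1_less not_le)
  qed
  have "\<forall>a. \<exists>u c. a \<in> D \<longrightarrow> u \<in> U \<and> x a = u + (\<Sum>b\<in>E. c b *\<^sub>R x b)"
  proof
    fix a
    show "\<exists>u c. a \<in> D \<longrightarrow> u \<in> U \<and> x a = u + (\<Sum>b\<in>E. c b *\<^sub>R x b)"
    proof (cases "a \<in> D")
      case True
      then have "x a \<in> span (U \<union> x ` E)" using E by blast
      then obtain u w where "x a = u + w" "u \<in> span U" "w \<in> span (x ` E)"
        by (auto simp: span_Un)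
      then show ?thesis using span_image_iff[OF finE] U by (metis span_eq_iff)
    qed simp
  qed
  then obtain u c where uc: "\<And>a. a \<in> D \<Longrightarrow> u a \<in> U"
    "\<And>a. a \<in> D \<Longrightarrow> x a = u a + (\<Sum>b\<in>E. c a b *\<^sub>R x b)" by metis
  have coeff: "y b q + (\<Sum>a\<in>D - E. y a q * c a b) = 0" if b: "b \<in> E" for b q
  proof -
    have "(\<Sum>a\<in>D. y a q *\<^sub>R x a) = (\<Sum>a\<in>E. y a q *\<^sub>R x a) + (\<Sum>a\<in>D - E. y a q *\<^sub>R x a)"
      by (subst sum.subset_diff[of E D]) (use E fin in auto)
    also have "(\<Sum>a\<in>D - E. y a q *\<^sub>R x a) =
        (\<Sum>a\<in>D - E. y a q *\<^sub>R u a) + (\<Sum>a\<in>D - E. \<Sum>b\<in>E. (y a q * c a b) *\<^sub>R x b)"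
      unfolding sum.distrib[symmetric]
      by (rule sum.cong[OF refl], subst uc(2))
         (auto simp: scaleR_add_right scaleR_right.sum)
    also have "(\<Sum>a\<in>D - E. \<Sum>b\<in>E. (y a q * c a b) *\<^sub>R x b) =
        (\<Sum>b\<in>E. (\<Sum>a\<in>D - E. y a q * c a b) *\<^sub>R x b)"
      by (subst sum.swap) (simp add: scaleR_left.sum)
    finally have "(\<Sum>b\<in>E. (y b q + (\<Sum>a\<in>D - E. y a q * c a b)) *\<^sub>R x b) =
        (\<Sum>a\<in>D. y a q *\<^sub>R x a) - (\<Sum>a\<in>D - E. y a q *\<^sub>R u a)"
      by (simp add: scaleR_add_left sum.distrib)
    also have "\<dots> \<in> U"
      by (intro subspace_diff[OF U] rel subspace_sum[OF U] subspace_scale[OF U] uc) auto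
    finally show ?thesis
      using indep[OF b, of "\<lambda>b. y b q + (\<Sum>a\<in>D - E. y a q * c a b)"] by blast
  qed
  have "y b \<in> span (y ` (D - E))" if "b \<in> D" for b
  proof (cases "b \<in> E")
    case True
    have "y b = (\<Sum>a\<in>D - E. (- c a b) *\<^sub>R y a)"
    proof
      fix q
      show "y b q = (\<Sum>a\<in>D - E. (- c a b) *\<^sub>R y a) q"
        using coeff[OF True, of q] by (simp add: sum_fun_apply sum_negf mult.commute)
    qed
    also have "\<dots> \<in> span (y ` (D - E))"
      by (intro span_sum span_scale span_base) auto
    finally show ?thesis .
  next
    case False
    then show ?thesis using that by (auto intro: span_base)
  qed
  then show ?thesis using that E by blast
qed

section \<open>The rank of an unsplittable family of product tensors\<close>

definition tensor :: "('p \<Rightarrow> real) \<Rightarrow> ('q \<Rightarrow> real) \<Rightarrow> 'p \<times> 'q \<Rightarrow> real" where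
  "tensor x y = (\<lambda>(p, q). x p * y q)"

lemma tensor_apply [simp]: "tensor x y (p, q) = x p * y q"
  by (simp add: tensor_def)

text \<open>The dimension of the span of the \<open>x a \<otimes> y a\<close> is at least \<open>d\<^sub>x + d\<^sub>y - 1\<close>, where \<open>d\<^sub>x\<close> and \<open>d\<^sub>y\<close>
  are the dimensions of the spans of the factors. (The sets \<open>P\<close>, \<open>Q\<close> generate and \<open>R\<close> is
  independent, so their cardinalities bound \<open>d\<^sub>x\<close>, \<open>d\<^sub>y\<close> from above and the dimension of the
  tensors from below.) The bound is an equality for \<open>{a\<^sub>0}\<close> and is preserved while the index set
  \<open>S\<close> grows. Since the family does not split, the tensors on \<open>S\<close> and those outside \<open>S\<close> have spans
  that meet; take a minimal \<open>D\<close> outside \<open>S\<close> whose span meets that of \<open>S\<close> in some \<open>w \<noteq> 0\<close>. By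
  minimality \<open>D\<close> adds \<open>card D - 1\<close> to the rank of the tensors. Modulo the span of the \<open>x a\<close> with
  \<open>a \<in> S\<close>, the relation expressing \<open>w\<close> becomes a vanishing sum, so by \<open>relation_split\<close> the new
  dimensions of the two factors add up to at most \<open>card D\<close>; one more is saved because a slice of
  \<open>w\<close> is a nonzero vector common to the two spans of \<open>y\<close>.\<close>

lemma tensor_family_span_rank:
  fixes x :: "'i \<Rightarrow> 'p \<Rightarrow> real" and y :: "'i \<Rightarrow> 'q \<Rightarrow> real"
  defines "v \<equiv> \<lambda>a. tensor (x a) (y a)"
  assumes fin: "finite T" and a0: "a\<^sub>0 \<in> T" "v a\<^sub>0 \<noteq> 0"
    and nonsplit: "\<And>S. S \<subset> T \<Longrightarrow> a\<^sub>0 \<in> S \<Longrightarrow> \<exists>w. w \<noteq> 0 \<and> w \<in> span (v ` S) \<inter> span (v ` (T - S))"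
  obtains P Q R where "P \<subseteq> T" "Q \<subseteq> T" "R \<subseteq> T" "x ` T \<subseteq> span (x ` P)" "y ` T \<subseteq> span (y ` Q)"
    "indep_family v R" "card P + card Q \<le> card R + 1"
proof -
  define good where "good S \<longleftrightarrow> a\<^sub>0 \<in> S \<and> S \<subseteq> T \<and> (\<exists>P Q R. P \<subseteq> S \<and> Q \<subseteq> S \<and> R \<subseteq> S \<and>
    x ` S \<subseteq> span (x ` P) \<and> y ` S \<subseteq> span (y ` Q) \<and> indep_family v R \<and> card P + card Q \<le> card R + 1)" for S
  have "good {a\<^sub>0}" unfolding good_def
    by (intro conjI exI[of _ "{a\<^sub>0}"]) (use a0 in \<open>auto simp: indep_family_def intro: span_base\<close>)
  moreover have fin_good: "finite {S. good S}"
    by (rule finite_subset[of _ "Pow T"]) (use fin in \<open>auto simp: good_def\<close>)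
  ultimately obtain S where S: "good S" and max: "\<And>S'. good S' \<Longrightarrow> S \<subseteq> S' \<Longrightarrow> S = S'"
    using finite_has_maximal[of "{S. good S}"] by auto
  have "S = T"
  proof (rule ccontr)
    assume "S \<noteq> T"
    then have ST: "S \<subset> T" "a\<^sub>0 \<in> S" using S by (auto simp: good_def)
    obtain P Q R where PQR: "P \<subseteq> S" "Q \<subseteq> S" "R \<subseteq> S" "x ` S \<subseteq> span (x ` P)" "y ` S \<subseteq> span (y ` Q)"
      "indep_family v R" "card P + card Q \<le> card R + 1"
      using S by (auto simp: good_def)
    have finS: "finite S" using ST fin finite_subset by blast
    define touch where "touch D \<longleftrightarrow>
      D \<subseteq> T - S \<and> (\<exists>w. w \<noteq> 0 \<and> w \<in> span (v ` S) \<inter> span (v ` D))" for D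
    have "touch (T - S)" using nonsplit[OF ST] by (auto simp: touch_def)
    then obtain D where D: "touch D" and Dmin: "\<And>D'. touch D' \<Longrightarrow> card D \<le> card D'"
      using ex_has_least_nat[of touch "T - S" card] by auto
    have DS: "D \<inter> S = {}" "D \<subseteq> T" using D by (auto simp: touch_def)
    then have finD: "finite D" using fin finite_subset by blast
    have Dmin': "w = 0" if "D' \<subset> D" "w \<in> span (v ` S)" "w \<in> span (v ` D')" for D' w
    proof (rule ccontr)
      assume "w \<noteq> 0"
      then have "touch D'" using that D by (auto simp: touch_def)
      then have "card D \<le> card D'" by (rule Dmin)
      then show False using psubset_card_mono[OF finD that(1)] by simp
    qed
    obtain w where w: "w \<noteq> 0" "w \<in> span (v ` S)" "w \<in> span (v ` D)" using D by (auto simp: touch_def)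
    obtain \<alpha> where \<alpha>: "w = (\<Sum>a\<in>D. \<alpha> a *\<^sub>R v a)" using w span_image_iff[OF finD] by blast
    obtain \<beta> where \<beta>: "w = (\<Sum>a\<in>S. \<beta> a *\<^sub>R v a)" using w span_image_iff[OF finS] by blast
    have \<alpha>_nz: "\<alpha> b \<noteq> 0" if b: "b \<in> D" for b
    proof
      assume "\<alpha> b = 0"
      then have "w = (\<Sum>a\<in>D - {b}. \<alpha> a *\<^sub>R v a)" using \<alpha> b finD by (simp add: sum.remove)
      then have "w \<in> span (v ` (D - {b}))" using span_image_iff[of "D - {b}"] finD by blast
      then show False using Dmin'[of "D - {b}" w] w b by blast
    qed
    \<comment> \<open>Each slice of \<open>w\<close> in the second variable lies in the span of the old \<open>x a\<close>, as \<open>w\<close> does in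
      the span of the old tensors. The coefficients \<open>\<alpha>\<close> are moved into \<open>y\<close>.\<close>
    have slice_x: "(\<Sum>a\<in>D. (\<alpha> a *\<^sub>R y a) q *\<^sub>R x a) \<in> span (x ` P)" for q
    proof -
      have "(\<Sum>a\<in>D. (\<alpha> a *\<^sub>R y a) q *\<^sub>R x a) = (\<lambda>p. w (p, q))"
        unfolding \<alpha> by (rule ext) (simp add: sum_fun_apply v_def mult_ac)
      also have "\<dots> = (\<Sum>a\<in>S. (\<beta> a *\<^sub>R y a) q *\<^sub>R x a)"
        unfolding \<beta> by (rule ext) (simp add: sum_fun_apply v_def mult_ac)
      also have "\<dots> \<in> span (x ` P)"
        by (intro span_sum span_scale) (use PQR in auto)
      finally show ?thesis .
    qed
    obtain E where E: "E \<subseteq> D" "x ` D \<subseteq> span (span (x ` P) \<union> x ` E)"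
      "(\<lambda>a. \<alpha> a *\<^sub>R y a) ` D \<subseteq> span ((\<lambda>a. \<alpha> a *\<^sub>R y a) ` (D - E))"
      using relation_split[of D "span (x ` P)" "\<lambda>a. \<alpha> a *\<^sub>R y a" x] finD slice_x by auto
    have x_span: "x ` (S \<union> D) \<subseteq> span (x ` (P \<union> E))"
    proof -
      have "span (x ` P) \<union> x ` E \<subseteq> span (x ` (P \<union> E))"
        using span_mono[of "x ` P" "x ` (P \<union> E)"] by (auto intro: span_base)
      then have "span (span (x ` P) \<union> x ` E) \<subseteq> span (x ` (P \<union> E))" by (simp add: span_minimal)
      then have "x ` D \<subseteq> span (x ` (P \<union> E))" by (rule order_trans[OF E(2)])
      moreover have "x ` S \<subseteq> span (x ` (P \<union> E))"
        by (rule order_trans[OF PQR(4) span_mono]) auto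
      ultimately show ?thesis by (simp add: image_Un)
    qed
    have yD: "y ` D \<subseteq> span (y ` (D - E))"
    proof -
      have "(\<lambda>a. \<alpha> a *\<^sub>R y a) ` (D - E) \<subseteq> span (y ` (D - E))" by (auto intro: span_scale span_base)
      then have "(\<lambda>a. \<alpha> a *\<^sub>R y a) ` D \<subseteq> span (y ` (D - E))"
        by (intro order_trans[OF E(3)] span_minimal) auto
      then have "\<alpha> b *\<^sub>R y b \<in> span (y ` (D - E))" if "b \<in> D" for b using that by blast
      then have "(1 / \<alpha> b) *\<^sub>R (\<alpha> b *\<^sub>R y b) \<in> span (y ` (D - E))" if "b \<in> D" for b
        using that span_scale by blast
      then show ?thesis using \<alpha>_nz by auto
    qed
    \<comment> \<open>A slice \<open>y'\<close> of \<open>w\<close> in the first variable is a common vector of the old and the new span of \<open>y\<close>;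
      it replaces one generator \<open>y e\<close>.\<close>
    obtain p q where pq: "w (p, q) \<noteq> 0" using w(1) by (metis ext surj_pair zero_fun_apply)
    define y' where "y' = (\<lambda>q. w (p, q))"
    have "y' \<noteq> 0" using pq by (auto simp: y'_def fun_eq_iff)
    have "y' = (\<Sum>a\<in>S. (\<beta> a * x a p) *\<^sub>R y a)"
      unfolding y'_def \<beta> by (rule ext) (simp add: sum_fun_apply v_def mult_ac)
    also have "\<dots> \<in> span (y ` Q)"
      by (intro span_sum span_scale) (use PQR in auto)
    finally have y'Q: "y' \<in> span (y ` Q)" .
    have "y' = (\<Sum>a\<in>D. (\<alpha> a * x a p) *\<^sub>R y a)"
      unfolding y'_def \<alpha> by (rule ext) (simp add: sum_fun_apply v_def mult_ac)
    also have "\<dots> \<in> span (y ` (D - E))"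
      by (intro span_sum span_scale) (use yD in auto)
    finally obtain \<gamma> where \<gamma>: "y' = (\<Sum>a\<in>D - E. \<gamma> a *\<^sub>R y a)"
      using span_image_iff[of "D - E"] finD by auto
    then obtain e where e: "e \<in> D - E" "\<gamma> e \<noteq> 0"
      using \<open>y' \<noteq> 0\<close> by (metis (mono_tags, lifting) scale_zero_left sum.neutral)
    let ?Q = "Q \<union> (D - E - {e})"
    have QQ: "span (y ` Q) \<subseteq> span (y ` ?Q)" by (rule span_mono) auto
    have "y e \<in> span (insert y' (y ` (D - E - {e})))"
      by (rule in_span_solve[where c=\<gamma>]) (use e \<gamma> finD in auto)
    also have "\<dots> \<subseteq> span (y ` ?Q)"
      by (rule span_minimal) (use y'Q QQ in \<open>auto intro: span_base\<close>)
    finally have "y ` (D - E) \<subseteq> span (y ` ?Q)" by (auto intro: span_base)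
    then have "y ` D \<subseteq> span (y ` ?Q)" by (intro order_trans[OF yD] span_minimal) auto
    moreover have "y ` S \<subseteq> span (y ` ?Q)" using PQR(5) QQ by (rule order_trans)
    ultimately have y_span: "y ` (S \<union> D) \<subseteq> span (y ` ?Q)" by (simp add: image_Un)
    \<comment> \<open>Any one element of \<open>D\<close> may be dropped, by minimality of \<open>D\<close>; \<open>e\<close> is at hand.\<close>
    have De: "D - {e} \<subset> D" using e by blast
    have v_indep: "indep_family v (R \<union> (D - {e}))"
      unfolding indep_family_def
    proof (intro allI impI)
      fix c assume c: "(\<Sum>a\<in>R \<union> (D - {e}). c a *\<^sub>R v a) = 0"
      define s where "s = (\<Sum>a\<in>D - {e}. c a *\<^sub>R v a)"
      have Rs: "(\<Sum>a\<in>R. c a *\<^sub>R v a) = - s"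
      proof -
        have "(\<Sum>a\<in>R \<union> (D - {e}). c a *\<^sub>R v a) = (\<Sum>a\<in>R. c a *\<^sub>R v a) + s"
          unfolding s_def by (rule sum.union_disjoint)
             (use PQR DS finD finS finite_subset in auto)
        then show ?thesis using c by (simp add: add_eq_0_iff2)
      qed
      have "- s \<in> span (v ` S)" unfolding Rs[symmetric]
        by (intro span_sum span_scale span_base) (use PQR in auto)
      then have "s \<in> span (v ` S)" using span_neg by fastforce
      moreover have "s \<in> span (v ` (D - {e}))" unfolding s_def
        by (intro span_sum span_scale span_base) auto
      ultimately have s0: "s = 0" using Dmin'[OF De] by blast
      have "c a = 0" if a: "a \<in> D - {e}" for a
      proof (rule ccontr)
        assume "c a \<noteq> 0"
        then have "v a \<in> span (insert s (v ` (D - {e} - {a})))"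
          by (intro in_span_solve[where c=c]) (use a finD s_def in auto)
        also have "\<dots> \<subseteq> span (v ` (D - {a}))"
          by (rule span_minimal) (use s0 in \<open>auto intro: span_base span_zero\<close>)
        finally have "v ` D \<subseteq> span (v ` (D - {a}))" by (auto intro: span_base)
        then have "w \<in> span (v ` (D - {a}))"
          using w(3) span_minimal[OF _ subspace_span] by blast
        then show False using Dmin'[of "D - {a}" w] w a by blast
      qed
      moreover have "c a = 0" if "a \<in> R" for a
        using indep_familyD[OF PQR(6), of c a] Rs s0 that by simp
      ultimately show "\<forall>a\<in>R \<union> (D - {e}). c a = 0" by blast
    qed
    have "card (P \<union> E) + card ?Q \<le> (card P + card E) + (card Q + card (D - E - {e}))"
      by (intro add_mono card_Un_le)
    also have "card (D - E - {e}) = card D - card E - 1"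
      using e E finD by (simp add: card_Diff_subset finite_subset)
    also have "card P + card E + (card Q + (card D - card E - 1)) = card P + card Q + (card D - 1)"
    proof -
      have "card E + 1 \<le> card D"
        using psubset_card_mono[OF finD, of E] E(1) e by (metis DiffD1 DiffD2 Suc_eq_plus1 Suc_leI psubsetI)
      then show ?thesis by simp
    qed
    also have "\<dots> \<le> (card R + 1) + (card D - 1)" using PQR(7) by simp
    also have "\<dots> = card (R \<union> (D - {e})) + 1"
    proof -
      have "card (R \<union> (D - {e})) = card R + card (D - {e})"
        by (rule card_Un_disjoint) (use PQR DS finD finS finite_subset in auto)
      then show ?thesis using e finD by simp
    qed
    finally have "good (S \<union> D)" unfolding good_def
      using ST DS PQR E(1) x_span y_span v_indep
      by (intro conjI exI[of _ "P \<union> E"] exI[of _ ?Q] exI[of _ "R \<union> (D - {e})"]) auto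
    then have "S = S \<union> D" using max by blast
    then show False using e DS by blast
  qed
  then show ?thesis using S that by (auto simp: good_def)
qed

section \<open>Kruskal's uniqueness theorem\<close>

text \<open>A vanishing sum of triple products without shorter vanishing subsums through \<open>a\<^sub>0\<close> satisfies
  \<open>d\<^sub>x + d\<^sub>y + d\<^sub>z \<le> card T + 1\<close>. Minimality makes the family \<open>x a \<otimes> y a\<close> unsplittable: if the spans
  of two complementary parts met only in \<open>0\<close>, each part of the sum would vanish on its own. So
  these tensors have rank at least \<open>d\<^sub>x + d\<^sub>y - 1\<close>, and \<open>relation_split\<close> against \<open>z\<close> bounds
  that rank plus \<open>d\<^sub>z\<close> by \<open>card T\<close>.\<close>

lemma minimal_zero_sum_spanning:
  fixes x :: "'i \<Rightarrow> 'p \<Rightarrow> real" and y :: "'i \<Rightarrow> 'q \<Rightarrow> real" and z :: "'i \<Rightarrow> 's \<Rightarrow> real"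
  assumes fin: "finite T" and zero: "\<And>p q s. (\<Sum>a\<in>T. x a p * y a q * z a s) = 0"
    and a0: "a\<^sub>0 \<in> T" "x a\<^sub>0 \<noteq> 0" "y a\<^sub>0 \<noteq> 0"
    and minimal: "\<And>S. S \<subset> T \<Longrightarrow> a\<^sub>0 \<in> S \<Longrightarrow> \<exists>p q s. (\<Sum>a\<in>S. x a p * y a q * z a s) \<noteq> 0"
  obtains P Q W where "P \<subseteq> T" "Q \<subseteq> T" "W \<subseteq> T" "x ` T \<subseteq> span (x ` P)" "y ` T \<subseteq> span (y ` Q)"
    "z ` T \<subseteq> span (z ` W)" "card P + card Q + card W \<le> card T + 1"
proof -
  define v where "v = (\<lambda>a. tensor (x a) (y a))"
  have zero': "(\<Sum>a\<in>T. z a s *\<^sub>R v a) = 0" for s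
  proof
    fix pq :: "'p \<times> 'q"
    obtain p q where "pq = (p, q)" by (cases pq)
    then show "(\<Sum>a\<in>T. z a s *\<^sub>R v a) pq = 0 pq"
      using zero[of p q s] by (simp add: sum_fun_apply v_def mult_ac)
  qed
  obtain p where p: "x a\<^sub>0 p \<noteq> 0" using a0(2) by (auto simp: fun_eq_iff)
  obtain q where q: "y a\<^sub>0 q \<noteq> 0" using a0(3) by (auto simp: fun_eq_iff)
  have "v a\<^sub>0 (p, q) \<noteq> 0" using p q by (simp add: v_def)
  then have v0: "tensor (x a\<^sub>0) (y a\<^sub>0) \<noteq> 0" by (metis v_def zero_fun_apply)
  have nonsplit: "\<exists>w. w \<noteq> 0 \<and> w \<in> span (v ` S) \<inter> span (v ` (T - S))" if S: "S \<subset> T" "a\<^sub>0 \<in> S" for S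
  proof -
    obtain p q s where pqs: "(\<Sum>a\<in>S. x a p * y a q * z a s) \<noteq> 0" using minimal[OF S] by blast
    define w where "w = (\<Sum>a\<in>S. z a s *\<^sub>R v a)"
    have "w (p, q) \<noteq> 0" using pqs by (simp add: w_def sum_fun_apply v_def mult_ac)
    then have "w \<noteq> 0" by auto
    moreover have "w \<in> span (v ` S)" unfolding w_def by (intro span_sum span_scale span_base) auto
    moreover have "w \<in> span (v ` (T - S))"
    proof -
      have "(\<Sum>a\<in>T - S. z a s *\<^sub>R v a) + w = 0"
        using sum.subset_diff[of S T "\<lambda>a. z a s *\<^sub>R v a"] S(1) fin zero'[of s] by (simp add: w_def)
      then have "w = - (\<Sum>a\<in>T - S. z a s *\<^sub>R v a)" by (simp add: eq_neg_iff_add_eq_0 add.commute)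
      also have "\<dots> \<in> span (v ` (T - S))"
        by (intro span_neg span_sum span_scale span_base) auto
      finally show ?thesis .
    qed
    ultimately show ?thesis by blast
  qed
  obtain P Q R where PQR: "P \<subseteq> T" "Q \<subseteq> T" "R \<subseteq> T" "x ` T \<subseteq> span (x ` P)" "y ` T \<subseteq> span (y ` Q)"
    "indep_family v R" "card P + card Q \<le> card R + 1"
    using nonsplit
    by (rule tensor_family_span_rank[of T a\<^sub>0 x y, OF fin a0(1) v0, folded v_def]) blast+
  obtain E where E: "E \<subseteq> T" "v ` T \<subseteq> span ({0} \<union> v ` E)" "z ` T \<subseteq> span (z ` (T - E))"
    using relation_split[of T "{0}" z v] fin zero' by auto
  have finE: "finite E" using E fin finite_subset by blast
  have "card R \<le> card (v ` E)"
  proof (rule indep_family_card_le[OF _ PQR(6)])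
    show "finite R" using PQR fin finite_subset by blast
    show "v ` R \<subseteq> span (v ` E)" using E(2) PQR(3) by auto
  qed (use finE in simp)
  also have "\<dots> \<le> card E" using finE by (rule card_image_le)
  finally have "card P + card Q + card (T - E) \<le> card T + 1"
    using PQR(7) E(1) fin finE card_mono[OF fin E(1)] by (simp add: card_Diff_subset)
  then show ?thesis using that[of P Q "T - E"] PQR E by blast
qed

text \<open>The Kruskal rank is the largest \<open>k\<close> such that any \<open>k\<close> members are independent. Only lower bounds
  on it occur. A bound \<open>k\<close> above the size of the family means that the whole family is independent.\<close>

definition kruskal_rank_ge :: "nat \<Rightarrow> ('i \<Rightarrow> 'v::real_vector) \<Rightarrow> 'i set \<Rightarrow> bool" where
  "kruskal_rank_ge k x I \<longleftrightarrow> (\<forall>A\<subseteq>I. card A \<le> k \<longrightarrow> indep_family x A)"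

lemma kruskal_rank_ge_mono: "kruskal_rank_ge k x I \<Longrightarrow> I' \<subseteq> I \<Longrightarrow> kruskal_rank_ge k x I'"
  by (auto simp: kruskal_rank_ge_def)

lemma kruskal_rank_ge_scale:
  assumes "kruskal_rank_ge m x I" "\<And>i. i \<in> I \<Longrightarrow> d i \<noteq> 0"
  shows "kruskal_rank_ge m (\<lambda>i. d i *\<^sub>R x i) I"
  unfolding kruskal_rank_ge_def
proof (intro allI impI)
  fix A assume A: "A \<subseteq> I" "card A \<le> m"
  then have "indep_family x A" using assms by (simp add: kruskal_rank_ge_def)
  then have "\<forall>i\<in>A. c i * d i = 0" if "(\<Sum>i\<in>A. c i *\<^sub>R d i *\<^sub>R x i) = 0" for c
    using indep_familyD[of x A "\<lambda>i. c i * d i"] that by simp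
  then show "indep_family (\<lambda>i. d i *\<^sub>R x i) A"
    using A assms(2) by (auto simp: indep_family_def)
qed

lemma kruskal_rank_ge_le: "kruskal_rank_ge m x I \<Longrightarrow> n \<le> m \<Longrightarrow> kruskal_rank_ge n x I"
  by (auto simp: kruskal_rank_ge_def)

lemma kruskal_rank_ge_nonzero:
  assumes "kruskal_rank_ge k x I" "1 \<le> k" "i \<in> I"
  shows "x i \<noteq> 0"
proof
  assume "x i = 0"
  moreover have "indep_family x {i}" using assms by (auto simp: kruskal_rank_ge_def)
  ultimately show False using indep_familyD[of x "{i}" "\<lambda>_. 1" i] by simp
qed

lemma min_kruskal_rank_le_card:
  assumes "kruskal_rank_ge k x I" "A \<subseteq> I" "finite A" "finite B" "x ` A \<subseteq> span B"
  shows "min k (card A) \<le> card B"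
proof -
  obtain C where C: "C \<subseteq> A" "card C = min k (card A)" "finite C"
    using obtain_subset_with_card_n[of "min k (card A)" A] by auto
  then have "indep_family x C" using assms by (auto simp: kruskal_rank_ge_def)
  then have "card C \<le> card B" by (rule indep_family_card_le[OF C(3) _ assms(4)]) (use C assms in auto)
  then show ?thesis using C by simp
qed

text \<open>Move both decompositions to one side and consider the shortest vanishing subsum that involves at
  least as many left terms as right terms, and at least one left term. It is minimal, since the
  complement of a vanishing subsum also vanishes and one of the two has the required balance.
  With \<open>n\<close> left terms it has at most \<open>2 * n\<close> terms, so \<open>minimal_zero_sum_spanning\<close> bounds the sum
  of the three dimensions by \<open>2 * n + 1\<close>. The Kruskal ranks bound it below by \<open>2 * n + 2\<close> unless
  \<open>n = 1\<close>. So one left term equals one right term; both are removed and the argument repeats.\<close>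

theorem kruskal_uniqueness:
  fixes x :: "'i \<Rightarrow> 'p \<Rightarrow> real" and y :: "'i \<Rightarrow> 'q \<Rightarrow> real" and z :: "'i \<Rightarrow> 's \<Rightarrow> real"
    and x' :: "'j \<Rightarrow> 'p \<Rightarrow> real" and y' :: "'j \<Rightarrow> 'q \<Rightarrow> real" and z' :: "'j \<Rightarrow> 's \<Rightarrow> real"
  assumes "finite I" "finite J" "card J \<le> card I"
    and "kruskal_rank_ge k1 x I" "kruskal_rank_ge k2 y I" "kruskal_rank_ge k3 z I"
    and k1: "1 \<le> k1" "1 \<le> k2" "1 \<le> k3"
    and "\<And>n. 2 \<le> n \<Longrightarrow> n \<le> card I \<Longrightarrow> 2 * n + 2 \<le> min k1 n + min k2 n + min k3 n"
    and "\<And>p q s. (\<Sum>i\<in>I. x i p * y i q * z i s) = (\<Sum>j\<in>J. x' j p * y' j q * z' j s)"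
  shows "\<exists>\<sigma>. bij_betw \<sigma> I J \<and> (\<forall>i\<in>I. \<forall>p q s. x i p * y i q * z i s = x' (\<sigma> i) p * y' (\<sigma> i) q * z' (\<sigma> i) s)"
  using assms(1-6,10-)
proof (induction "card I" arbitrary: I J)
  case 0
  then have "I = {}" "J = {}" by auto
  then show ?case by (simp add: bij_betw_def)
next
  case (Suc m)
  note fin = Suc.prems(1,2)
  let ?t = "\<lambda>i p q s. x i p * y i q * z i s" and ?t' = "\<lambda>j p q s. x' j p * y' j q * z' j s"
  define bal where "bal = (\<lambda>(A, B). A \<subseteq> I \<and> B \<subseteq> J \<and> A \<noteq> {} \<and> card B \<le> card A \<and>
    (\<forall>p q s. (\<Sum>i\<in>A. ?t i p q s) = (\<Sum>j\<in>B. ?t' j p q s)))"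
  have "bal (I, J)" using Suc.prems(3,8) Suc.hyps(2) by (auto simp: bal_def)
  then obtain AB where AB: "bal AB" and least: "\<And>AB'. bal AB' \<Longrightarrow> card (fst AB) + card (snd AB) \<le> card (fst AB') + card (snd AB')"
    using ex_has_least_nat[of bal "(I, J)" "\<lambda>AB. card (fst AB) + card (snd AB)"] by auto
  obtain A B where [simp]: "AB = (A, B)" by (cases AB)
  have AB: "A \<subseteq> I" "B \<subseteq> J" "A \<noteq> {}" "card B \<le> card A"
    and eq: "\<And>p q s. (\<Sum>i\<in>A. ?t i p q s) = (\<Sum>j\<in>B. ?t' j p q s)"
    using AB by (auto simp: bal_def)
  have finA: "finite A" and finB: "finite B" using AB fin finite_subset by auto
  \<comment> \<open>Either the subsum over \<open>A1\<close>, \<open>B1\<close> or its complement in \<open>A\<close>, \<open>B\<close> would be a shorter choice.\<close>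
  have minimal: "\<exists>p q s. (\<Sum>i\<in>A1. ?t i p q s) \<noteq> (\<Sum>j\<in>B1. ?t' j p q s)"
    if sub: "A1 \<subseteq> A" "B1 \<subseteq> B" "A1 \<noteq> {}" "A1 \<noteq> A \<or> B1 \<noteq> B" for A1 B1
  proof (rule ccontr)
    assume "\<not> ?thesis"
    then have eq1: "\<And>p q s. (\<Sum>i\<in>A1. ?t i p q s) = (\<Sum>j\<in>B1. ?t' j p q s)" by blast
    have fin1: "finite A1" "finite B1" using sub finA finB finite_subset by auto
    have le: "card A1 \<le> card A" "card B1 \<le> card B" using sub finA finB by (auto intro: card_mono)
    show False
    proof (cases "card B1 \<le> card A1")
      case True
      then have "bal (A1, B1)" using sub AB eq1 by (auto simp: bal_def)
      then have "card A + card B \<le> card A1 + card B1" using least by fastforce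
      then have "card A1 = card A" "card B1 = card B" using le by auto
      then show False using card_subset_eq[OF finA sub(1)] card_subset_eq[OF finB sub(2)] sub(4) by blast
    next
      case False
      have cards: "card (A - A1) = card A - card A1" "card (B - B1) = card B - card B1"
        using sub fin1 by (auto simp: card_Diff_subset)
      have "card (B - B1) < card (A - A1)" using False le AB(4) cards by linarith
      moreover have "(\<Sum>i\<in>A - A1. ?t i p q s) = (\<Sum>j\<in>B - B1. ?t' j p q s)" for p q s
        using eq[of p q s] eq1[of p q s] sub finA finB by (simp add: sum_diff)
      moreover from calculation(1) have "A - A1 \<noteq> {}" by (metis card.empty not_less_zero)
      ultimately have "bal (A - A1, B - B1)" using AB(1,2) by (auto simp: bal_def)
      then have "card A + card B \<le> card (A - A1) + card (B - B1)" using least by fastforce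
      moreover have "card A1 > 0" using sub(3) fin1 by (simp add: card_gt_0_iff)
      ultimately show False using cards le by linarith
    qed
  qed
  \<comment> \<open>The sign of the right terms is absorbed in the first factor.\<close>
  define X Y Z where "X = case_sum x (\<lambda>j. - x' j)" and "Y = case_sum y y'" and "Z = case_sum z z'"
  have sum_XYZ: "(\<Sum>a\<in>A1 <+> B1. X a p * Y a q * Z a s) =
      (\<Sum>i\<in>A1. ?t i p q s) - (\<Sum>j\<in>B1. ?t' j p q s)" if "finite A1" "finite B1" for A1 B1 p q s
    using that by (simp add: sum.Plus X_def Y_def Z_def sum_negf)
  obtain i where i: "i \<in> A" using AB by blast
  note kr = Suc.prems(4-6)
  have nz: "x i \<noteq> 0" "y i \<noteq> 0" "z i \<noteq> 0"
    using kruskal_rank_ge_nonzero[OF kr(1) k1(1)] kruskal_rank_ge_nonzero[OF kr(2) k1(2)]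
      kruskal_rank_ge_nonzero[OF kr(3) k1(3)] i AB by auto
  obtain P Q W where PQW: "P \<subseteq> A <+> B" "Q \<subseteq> A <+> B" "W \<subseteq> A <+> B"
    "X ` (A <+> B) \<subseteq> span (X ` P)" "Y ` (A <+> B) \<subseteq> span (Y ` Q)" "Z ` (A <+> B) \<subseteq> span (Z ` W)"
    "card P + card Q + card W \<le> card (A <+> B) + 1"
  proof (rule minimal_zero_sum_spanning[of "A <+> B" X Y Z "Inl i"])
    show "finite (A <+> B)" using finA finB by simp
    show "(\<Sum>a\<in>A <+> B. X a p * Y a q * Z a s) = 0" for p q s
      using sum_XYZ[OF finA finB] eq by simp
    show "Inl i \<in> A <+> B" using i by (rule InlI)
    show "X (Inl i) \<noteq> 0" "Y (Inl i) \<noteq> 0" using nz by (simp_all add: X_def Y_def)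
    fix S assume S: "S \<subset> A <+> B" "Inl i \<in> S"
    define A1 B1 where "A1 = Inl -` S" and "B1 = Inr -` S"
    have S_eq: "S = A1 <+> B1" unfolding A1_def B1_def
    proof (rule set_eqI)
      fix s show "s \<in> S \<longleftrightarrow> s \<in> Inl -` S <+> Inr -` S" by (cases s) auto
    qed
    have sub: "A1 \<subseteq> A" "B1 \<subseteq> B" using S(1) by (auto simp: A1_def B1_def)
    have "A1 \<noteq> {}" using S(2) by (auto simp: A1_def)
    moreover have "A1 \<noteq> A \<or> B1 \<noteq> B" using S(1) S_eq by auto
    ultimately obtain p q s where "(\<Sum>i\<in>A1. ?t i p q s) \<noteq> (\<Sum>j\<in>B1. ?t' j p q s)"
      using minimal[OF sub] by blast
    moreover have "finite A1" "finite B1" using sub finA finB finite_subset by auto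
    ultimately have "(\<Sum>a\<in>A1 <+> B1. X a p * Y a q * Z a s) \<noteq> 0" by (simp add: sum_XYZ)
    then show "\<exists>p q s. (\<Sum>a\<in>S. X a p * Y a q * Z a s) \<noteq> 0"
      unfolding S_eq by blast
  qed
  have finPQW: "finite P" "finite Q" "finite W" 
    using PQW(1-3) finite_subset[OF _ finite_Plus[OF finA finB]] by auto
  have "min k1 (card A) \<le> card (X ` P)"
  proof (rule min_kruskal_rank_le_card[OF kr(1) AB(1) finA])
    have "x a = X (Inl a)" for a by (simp add: X_def)
    then show "x ` A \<subseteq> span (X ` P)" using PQW(4) by auto
  qed (use finPQW in simp)
  then have P: "min k1 (card A) \<le> card P" using card_image_le[OF finPQW(1), of X] by linarith
  have "min k2 (card A) \<le> card (Y ` Q)"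
  proof (rule min_kruskal_rank_le_card[OF kr(2) AB(1) finA])
    have "y a = Y (Inl a)" for a by (simp add: Y_def)
    then show "y ` A \<subseteq> span (Y ` Q)" using PQW(5) by auto
  qed (use finPQW in simp)
  then have Q: "min k2 (card A) \<le> card Q" using card_image_le[OF finPQW(2), of Y] by linarith
  have "min k3 (card A) \<le> card (Z ` W)"
  proof (rule min_kruskal_rank_le_card[OF kr(3) AB(1) finA])
    have "z a = Z (Inl a)" for a by (simp add: Z_def)
    then show "z ` A \<subseteq> span (Z ` W)" using PQW(6) by auto
  qed (use finPQW in simp)
  then have W: "min k3 (card A) \<le> card W" using card_image_le[OF finPQW(3), of Z] by linarith
  have "card A \<le> 1"
  proof (rule ccontr)
    assume "\<not> card A \<le> 1"
    then have "2 * card A + 2 \<le> min k1 (card A) + min k2 (card A) + min k3 (card A)"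
      using card_mono[OF fin(1) AB(1)] by (intro Suc.prems(7)) auto
    then show False using P Q W PQW(7) AB(4) finA finB by (simp add: card_Plus)
  qed
  then have A: "A = {i}" using i finA by (auto simp: card_le_Suc0_iff_eq)
  have "B \<noteq> {}"
  proof
    assume "B = {}"
    then have "?t i p q s = 0" for p q s using eq[of p q s] A by simp
    then show False using nz by (auto simp: fun_eq_iff)
  qed
  then have "card B = 1" using AB(4) A finB by (simp add: card_gt_0_iff le_antisym Suc_leI)
  then obtain j where B: "B = {j}" by (auto simp: card_1_singleton_iff)
  have ij: "i \<in> I" "j \<in> J" using A B AB by auto
  have term_eq: "?t i p q s = ?t' j p q s" for p q s using eq[of p q s] A B by simp
  have "\<exists>\<sigma>. bij_betw \<sigma> (I - {i}) (J - {j}) \<and> (\<forall>l\<in>I - {i}. \<forall>p q s. ?t l p q s = ?t' (\<sigma> l) p q s)"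
  proof (rule Suc.hyps(1))
    show "m = card (I - {i})" using Suc.hyps(2) ij fin by simp
    show "card (J - {j}) \<le> card (I - {i})" using Suc.prems(3) ij fin by simp
    show "kruskal_rank_ge k1 x (I - {i})" "kruskal_rank_ge k2 y (I - {i})" "kruskal_rank_ge k3 z (I - {i})"
      using kr by (auto intro: kruskal_rank_ge_mono)
    show "2 * n + 2 \<le> min k1 n + min k2 n + min k3 n" if "2 \<le> n" "n \<le> card (I - {i})" for n
      using Suc.prems(7)[of n] that ij fin by simp
    show "(\<Sum>i\<in>I - {i}. ?t i p q s) = (\<Sum>j\<in>J - {j}. ?t' j p q s)" for p q s
      using Suc.prems(8)[of p q s] term_eq[of p q s] ij fin by (simp add: sum_diff1)
  qed (use fin in auto)
  then obtain \<sigma> where \<sigma>: "bij_betw \<sigma> (I - {i}) (J - {j})"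
    "\<And>l p q s. l \<in> I - {i} \<Longrightarrow> ?t l p q s = ?t' (\<sigma> l) p q s" by blast
  have "bij_betw (\<sigma>(i := j)) ((I - {i}) \<union> {i}) ((J - {j}) \<union> {j})"
    by (rule bij_betw_combine) (use \<sigma>(1) in \<open>auto simp: bij_betw_def inj_on_def\<close>)
  then have "bij_betw (\<sigma>(i := j)) I J" using ij by (simp add: insert_absorb)
  moreover have "\<forall>l\<in>I. \<forall>p q s. ?t l p q s = ?t' ((\<sigma>(i := j)) l) p q s"
    using \<sigma>(2) term_eq by auto
  ultimately show ?case by blast
qed

section \<open>Independence as a nonvanishing polynomial condition\<close>

lemma poly_funs_uminus: "f \<in> poly_funs I \<Longrightarrow> (\<lambda>x. - f x) \<in> poly_funs I"
  using poly_funs.mult[OF poly_funs.const[of "-1"], of f] by simp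

lemma poly_funs_diff: "f \<in> poly_funs I \<Longrightarrow> g \<in> poly_funs I \<Longrightarrow> (\<lambda>x. f x - g x) \<in> poly_funs I"
  using poly_funs.add[OF _ poly_funs_uminus, of f I g] by simp

lemma poly_funs_sum: "(\<And>a. a \<in> A \<Longrightarrow> f a \<in> poly_funs I) \<Longrightarrow> (\<lambda>x. \<Sum>a\<in>A. f a x) \<in> poly_funs I"
  by (induction A rule: infinite_finite_induct) (auto intro: poly_funs.intros)

lemma poly_funs_prod: "(\<And>a. a \<in> A \<Longrightarrow> f a \<in> poly_funs I) \<Longrightarrow> (\<lambda>x. \<Prod>a\<in>A. f a x) \<in> poly_funs I"
  by (induction A rule: infinite_finite_induct) (auto intro: poly_funs.intros)

text \<open>Fraction-free Gaussian elimination: at \<open>\<theta>\<^sub>0\<close> some entry of the row \<open>a\<close> is a nonzero pivot, and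
  clearing its column from the other rows keeps all entries polynomial. Wherever the pivot is
  nonzero, the family is independent if the cleared rows are. The product of the pivots is
  the wanted polynomial.\<close>

lemma indep_family_open_condition:
  fixes x :: "'a \<Rightarrow> 'l \<Rightarrow> ('i \<Rightarrow> real) \<Rightarrow> real"
  assumes "finite A" "\<And>a l. a \<in> A \<Longrightarrow> x a l \<in> poly_funs I"
    and "indep_family (\<lambda>a l. x a l \<theta>\<^sub>0) A"
  shows "\<exists>f\<in>poly_funs I. f \<theta>\<^sub>0 \<noteq> 0 \<and> (\<forall>\<theta>. f \<theta> \<noteq> 0 \<longrightarrow> indep_family (\<lambda>a l. x a l \<theta>) A)"
  using assms
proof (induction A arbitrary: x)
  case empty
  show ?case by (rule bexI[of _ "\<lambda>_. 1"]) (auto simp: indep_family_def intro: poly_funs.const)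
next
  case (insert a A)
  have "\<exists>l. x a l \<theta>\<^sub>0 \<noteq> 0"
  proof (rule ccontr)
    assume "\<not> ?thesis"
    then have "(\<Sum>b\<in>insert a A. (if b = a then 1 else 0) *\<^sub>R (\<lambda>l. x b l \<theta>\<^sub>0)) = 0"
      using insert.hyps by (auto simp: fun_eq_iff sum_fun_apply intro!: sum.neutral)
    from indep_familyD[OF insert.prems(2) this, of a] show False by simp
  qed
  then obtain l\<^sub>0 where l0: "x a l\<^sub>0 \<theta>\<^sub>0 \<noteq> 0" by blast
  define x' where "x' b l = (\<lambda>\<theta>. x a l\<^sub>0 \<theta> * x b l \<theta> - x b l\<^sub>0 \<theta> * x a l \<theta>)" for b l
  have elim: "(\<Sum>b\<in>A. c b * x' b l \<theta>) =
      x a l\<^sub>0 \<theta> * (\<Sum>b\<in>A. c b * x b l \<theta>) - (\<Sum>b\<in>A. c b * x b l\<^sub>0 \<theta>) * x a l \<theta>" for c l \<theta>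
    by (simp add: x'_def sum_subtractf sum_distrib_left sum_distrib_right algebra_simps)
  have "\<exists>f\<in>poly_funs I. f \<theta>\<^sub>0 \<noteq> 0 \<and> (\<forall>\<theta>. f \<theta> \<noteq> 0 \<longrightarrow> indep_family (\<lambda>a l. x' a l \<theta>) A)"
  proof (rule insert.IH)
    show "x' b l \<in> poly_funs I" if "b \<in> A" for b l
      unfolding x'_def using that insert.prems(1) by (intro poly_funs_diff poly_funs.mult) auto
    show "indep_family (\<lambda>b l. x' b l \<theta>\<^sub>0) A"
      unfolding indep_family_def
    proof (intro allI impI ballI)
      fix c b assume "(\<Sum>b\<in>A. c b *\<^sub>R (\<lambda>l. x' b l \<theta>\<^sub>0)) = 0" and b: "b \<in> A"
      then have c: "(\<Sum>b\<in>A. c b * x' b l \<theta>\<^sub>0) = 0" for l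
        by (auto simp: fun_eq_iff sum_fun_apply)
      define d where "d e = (if e = a then - (\<Sum>b\<in>A. c b * x b l\<^sub>0 \<theta>\<^sub>0) else x a l\<^sub>0 \<theta>\<^sub>0 * c e)" for e
      have "(\<Sum>e\<in>A. d e * x e l \<theta>\<^sub>0) = x a l\<^sub>0 \<theta>\<^sub>0 * (\<Sum>b\<in>A. c b * x b l \<theta>\<^sub>0)" for l
        unfolding sum_distrib_left
        by (rule sum.cong) (use insert.hyps in \<open>auto simp: d_def\<close>)
      then have "(\<Sum>e\<in>insert a A. d e * x e l \<theta>\<^sub>0) = (\<Sum>b\<in>A. c b * x' b l \<theta>\<^sub>0)" for l
        using insert.hyps by (simp add: elim) (simp add: d_def)
      then have "(\<Sum>e\<in>insert a A. d e *\<^sub>R (\<lambda>l. x e l \<theta>\<^sub>0)) = 0"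
        using c by (auto simp: fun_eq_iff sum_fun_apply)
      then have "d b = 0" using indep_familyD[OF insert.prems(2)] b by blast
      then show "c b = 0" using b l0 insert.hyps by (auto simp: d_def split: if_splits)
    qed
  qed
  then obtain f where f: "f \<in> poly_funs I" "f \<theta>\<^sub>0 \<noteq> 0"
    and f_indep: "\<And>\<theta>. f \<theta> \<noteq> 0 \<Longrightarrow> indep_family (\<lambda>a l. x' a l \<theta>) A" by blast
  show ?case
  proof (intro bexI conjI allI impI)
    show "(\<lambda>\<theta>. x a l\<^sub>0 \<theta> * f \<theta>) \<in> poly_funs I"
      using f insert.prems(1) by (intro poly_funs.mult) auto
    show "x a l\<^sub>0 \<theta>\<^sub>0 * f \<theta>\<^sub>0 \<noteq> 0" using l0 f by simp
    fix \<theta> assume nz: "x a l\<^sub>0 \<theta> * f \<theta> \<noteq> 0"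
    show "indep_family (\<lambda>a l. x a l \<theta>) (insert a A)"
      unfolding indep_family_def
    proof (intro allI impI)
      fix c assume "(\<Sum>b\<in>insert a A. c b *\<^sub>R (\<lambda>l. x b l \<theta>)) = 0"
      then have "(\<Sum>b\<in>insert a A. c b * x b l \<theta>) = 0" for l
        by (auto simp: fun_eq_iff sum_fun_apply)
      then have c: "(\<Sum>b\<in>A. c b * x b l \<theta>) = - (c a * x a l \<theta>)" for l
        using insert.hyps by (simp add: eq_neg_iff_add_eq_0 add.commute)
      then have "(\<Sum>b\<in>A. c b * x' b l \<theta>) = 0" for l
        by (simp add: elim)
      then have "(\<Sum>b\<in>A. c b *\<^sub>R (\<lambda>l. x' b l \<theta>)) = 0"
        by (auto simp: fun_eq_iff sum_fun_apply)
      then have cA: "\<forall>b\<in>A. c b = 0" using indep_familyD[OF f_indep] nz by auto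
      then have "c a * x a l\<^sub>0 \<theta> = 0" using c[of l\<^sub>0] by simp
      then show "\<forall>b\<in>insert a A. c b = 0" using cA nz by simp
    qed
  qed
qed

text \<open>A relation among the power vectors of distinct nodes extends to values of all polynomials of
  degree below \<open>n\<close>; the polynomial with roots at all nodes except \<open>t a\<close> isolates \<open>c a\<close>.\<close>

lemma vandermonde_indep:
  fixes t c :: "'a \<Rightarrow> real"
  assumes fin: "finite A" and inj: "inj_on t A" and n: "card A \<le> n"
    and zero: "\<And>m. m < n \<Longrightarrow> (\<Sum>a\<in>A. c a * t a ^ m) = 0" and a: "a \<in> A"
  shows "c a = 0"
proof -
  define P where "P = (\<Prod>b\<in>A - {a}. [:- t b, 1:])"
  have "degree P \<le> (\<Sum>b\<in>A - {a}. degree [:- t b, 1:])"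
    unfolding P_def using degree_prod_sum_le[of "A - {a}" "\<lambda>b. [:- t b, 1:]"] fin by (simp add: o_def)
  also have "\<dots> = card A - 1" using a fin by simp
  also have "\<dots> < n" using n a fin by (metis card_gt_0_iff diff_less empty_iff less_le_trans zero_less_one)
  finally have deg: "degree P < n" .
  have P_root: "poly P (t b) = 0" if "b \<in> A" "b \<noteq> a" for b
    unfolding P_def poly_prod by (rule prod_zero) (use fin that in auto)
  have "poly P (t a) \<noteq> 0"
    unfolding P_def poly_prod using fin inj a by (auto simp: inj_on_def)
  moreover have "(\<Sum>b\<in>A. c b * poly P (t b)) = c a * poly P (t a)"
    using fin a P_root by (subst sum.remove[of A a]) auto
  moreover have "(\<Sum>b\<in>A. c b * poly P (t b)) = (\<Sum>m\<le>degree P. coeff P m * (\<Sum>b\<in>A. c b * t b ^ m))"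
    by (simp add: poly_altdef sum_distrib_left mult_ac) (subst sum.swap, rule refl)
  moreover have "\<dots> = 0" by (rule sum.neutral) (use zero deg in auto)
  ultimately show ?thesis by simp
qed

section \<open>Generic Kruskal ranks of blocks of features\<close>

text \<open>The place values \<open>w\<close> let the digits \<open>l j - 1\<close>, with \<open>k j\<close> possible values in place \<open>j\<close>, represent
  every number below \<open>\<Prod>j\<in>S. k j\<close>. A product of powers \<open>t ^ ((l j - 1) * w j)\<close> over the places
  then runs through all powers \<open>t ^ n\<close> with \<open>n\<close> in that range.\<close>

definition mixed_radix :: "(nat \<Rightarrow> nat) \<Rightarrow> nat set \<Rightarrow> (nat \<Rightarrow> nat) \<Rightarrow> bool" where
  "mixed_radix k S w \<longleftrightarrow>
    (\<forall>n < (\<Prod>j\<in>S. k j). \<exists>l \<in> (\<Pi>\<^sub>E j\<in>S. {1..k j}). (\<Sum>j\<in>S. (l j - 1) * w j) = n)"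

lemma mixed_radix_cong:
  assumes "\<And>j. j \<in> S \<Longrightarrow> w j = w' j"
  shows "mixed_radix k S w \<longleftrightarrow> mixed_radix k S w'"
  using assms unfolding mixed_radix_def by (simp cong: sum.cong)

lemma ex_mixed_radix: "finite S \<Longrightarrow> \<exists>w. mixed_radix k S w"
proof (induction S rule: finite_induct)
  case empty
  show ?case by (auto simp: mixed_radix_def)
next
  case (insert j S)
  then obtain w where w: "mixed_radix k S w" by blast
  let ?K = "\<Prod>j\<in>S. k j"
  \<comment> \<open>The new place is the most significant one.\<close>
  have "mixed_radix k (insert j S) (w(j := ?K))"
    unfolding mixed_radix_def
  proof (intro allI impI)
    fix n assume "n < (\<Prod>j\<in>insert j S. k j)"
    then have n: "n < k j * ?K" using insert.hyps by simp
    then have "?K > 0" by (cases "?K = 0") auto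
    then have "n mod ?K < ?K" by simp
    then obtain l where l: "l \<in> (\<Pi>\<^sub>E j\<in>S. {1..k j})" "(\<Sum>j\<in>S. (l j - 1) * w j) = n mod ?K"
      using w unfolding mixed_radix_def by blast
    have div: "n div ?K < k j" using n by (simp add: less_mult_imp_div_less)
    let ?l = "l(j := n div ?K + 1)"
    have "(\<Sum>i\<in>S. (?l i - 1) * (w(j := ?K)) i) = (\<Sum>i\<in>S. (l i - 1) * w i)"
      by (rule sum.cong) (use insert.hyps in auto)
    then have "(\<Sum>i\<in>insert j S. (?l i - 1) * (w(j := ?K)) i) = n"
      using l insert.hyps by (simp add: div_mult_mod_eq)
    moreover have "?l \<in> (\<Pi>\<^sub>E j\<in>insert j S. {1..k j})"
      by (rule PiE_fun_upd) (use l(1) div in auto)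
    ultimately show "\<exists>l \<in> (\<Pi>\<^sub>E j\<in>insert j S. {1..k j}). (\<Sum>i\<in>insert j S. (l i - 1) * (w(j := ?K)) i) = n"
      by blast
  qed
  then show ?case by blast
qed

text \<open>The joint distribution of the features in \<open>S\<close> given class \<open>i\<close>. The extension by zero lets one
  index type serve all blocks \<open>S\<close>.\<close>

definition joint_row :: "(nat \<Rightarrow> nat) \<Rightarrow> nat set \<Rightarrow> cond_probs \<Rightarrow> nat \<Rightarrow> (nat \<Rightarrow> nat) \<Rightarrow> real" where
  "joint_row k S q i = (\<lambda>l. if l \<in> (\<Pi>\<^sub>E j\<in>S. {1..k j}) then \<Prod>j\<in>S. q i j (l j) else 0)"

lemma joint_row_cong:
  assumes "\<And>j l. j \<in> S \<Longrightarrow> l \<in> {1..k j} \<Longrightarrow> q i j l = q' i j l"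
  shows "joint_row k S q i = joint_row k S q' i"
  unfolding joint_row_def
proof (intro ext if_cong refl prod.cong)
  fix l j assume "l \<in> (\<Pi>\<^sub>E j\<in>S. {1..k j})" and j: "j \<in> S"
  then have "l j \<in> {1..k j}" by (rule PiE_mem)
  then show "q i j (l j) = q' i j (l j)" by (rule assms[OF j])
qed

text \<open>The inverse of dropping the last entry of each probability vector: that entry is one minus the sum
  of the others, hence a polynomial in the coordinates.\<close>

definition full_cond :: "(nat \<Rightarrow> nat) \<Rightarrow> (coord \<Rightarrow> real) \<Rightarrow> cond_probs" where
  "full_cond k \<theta> i j l =
    (if l < k j then \<theta> (Cond i j l) else 1 - (\<Sum>t\<in>{1..<k j}. \<theta> (Cond i j t)))"

lemma Cond_in_cond_coords:
  "Cond i j l \<in> cond_coords r p k \<longleftrightarrow> i \<in> {1..r} \<and> j \<in> {1..p} \<and> l \<in> {1..<k j}"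
  by (auto simp: cond_coords_def)

lemma full_cond_eq:
  assumes "\<And>t. t \<in> {1..<k j} \<Longrightarrow> \<theta> (Cond i j t) = q t" "(\<Sum>t=1..k j. q t) = 1" "l \<in> {1..k j}"
  shows "full_cond k \<theta> i j l = q l"
proof (cases "l < k j")
  case False
  then have l: "l = k j" "1 \<le> k j" using assms(3) by auto
  have "(\<Sum>t=1..k j. q t) = (\<Sum>t\<in>{1..<k j}. q t) + q (k j)"
    using l by (simp add: atLeastLessThanSuc_atLeastAtMost[symmetric])
  moreover have "(\<Sum>t\<in>{1..<k j}. \<theta> (Cond i j t)) = (\<Sum>t\<in>{1..<k j}. q t)"
    by (rule sum.cong) (use assms in auto)
  ultimately show ?thesis using assms(2) l by (simp add: full_cond_def)
qed (use assms in \<open>auto simp: full_cond_def\<close>)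

lemma full_cond_coord_vec:
  assumes "cond_coords r p k \<subseteq> I" "q \<in> cond_space r p k" "i \<in> {1..r}" "j \<in> {1..p}" "l \<in> {1..k j}"
  shows "full_cond k (coord_vec I (\<pi>, q)) i j l = q i j l"
proof (rule full_cond_eq)
  fix t assume "t \<in> {1..<k j}"
  then have "Cond i j t \<in> I" using assms by (auto simp: cond_coords_def)
  then show "coord_vec I (\<pi>, q) (Cond i j t) = q i j t" by (simp add: coord_vec_def)
qed (use assms in \<open>auto simp: cond_space_def\<close>)

lemma joint_row_full_cond_poly_fun:
  assumes "cond_coords r p k \<subseteq> I" "S \<subseteq> {1..p}" "i \<in> {1..r}"
  shows "(\<lambda>\<theta>. joint_row k S (full_cond k \<theta>) i l) \<in> poly_funs I"
proof (cases "l \<in> (\<Pi>\<^sub>E j\<in>S. {1..k j})")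
  case True
  have var: "(\<lambda>\<theta>. \<theta> (Cond i j t)) \<in> poly_funs I" if "j \<in> S" "t \<in> {1..<k j}" for j t
    using assms that by (intro poly_funs.var subsetD[OF assms(1)]) (auto simp: Cond_in_cond_coords)
  have "(\<lambda>\<theta>. full_cond k \<theta> i j (l j)) \<in> poly_funs I" if j: "j \<in> S" for j
  proof (cases "l j < k j")
    case True
    moreover have "l j \<in> {1..k j}" using \<open>l \<in> _\<close> j by auto
    ultimately show ?thesis using var[OF j, of "l j"] by (simp add: full_cond_def)
  next
    case False
    have "(\<lambda>\<theta>. 1 - (\<Sum>t\<in>{1..<k j}. \<theta> (Cond i j t))) \<in> poly_funs I"
      by (intro poly_funs_diff poly_funs.const poly_funs_sum var[OF j])
    then show ?thesis using False by (simp add: full_cond_def)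
  qed
  then show ?thesis using True by (simp add: joint_row_def poly_funs_prod)
next
  case False
  then show ?thesis by (simp add: joint_row_def poly_funs.const)
qed

lemma kruskal_rank_open_condition:
  fixes k :: "nat \<Rightarrow> nat"
  assumes "cond_coords r p k \<subseteq> I" "S \<subseteq> {1..p}"
    and "kruskal_rank_ge m (joint_row k S (full_cond k \<theta>\<^sub>0)) {1..r}"
  shows "\<exists>f\<in>poly_funs I. f \<theta>\<^sub>0 \<noteq> 0 \<and>
    (\<forall>\<theta>. f \<theta> \<noteq> 0 \<longrightarrow> kruskal_rank_ge m (joint_row k S (full_cond k \<theta>)) {1..r})"
proof -
  let ?\<A> = "{A. A \<subseteq> {1..r} \<and> card A \<le> m}"
  have fin: "finite ?\<A>" by simp
  define witness where "witness A f \<longleftrightarrow> f \<in> poly_funs I \<and> f \<theta>\<^sub>0 \<noteq> 0 \<and>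
    (\<forall>\<theta>. f \<theta> \<noteq> 0 \<longrightarrow> indep_family (joint_row k S (full_cond k \<theta>)) A)" for A f
  have "\<exists>f. witness A f" if A: "A \<in> ?\<A>" for A
    unfolding witness_def Bex_def[symmetric]
  proof (rule indep_family_open_condition[where x = "\<lambda>i l \<theta>. joint_row k S (full_cond k \<theta>) i l"])
    show "finite A" using A finite_subset by blast
    show "(\<lambda>\<theta>. joint_row k S (full_cond k \<theta>) i l) \<in> poly_funs I" if "i \<in> A" for i l
      by (rule joint_row_full_cond_poly_fun[OF assms(1,2)]) (use A that in blast)
    show "indep_family (joint_row k S (full_cond k \<theta>\<^sub>0)) A"
      using A assms(3) by (simp add: kruskal_rank_ge_def)
  qed
  then obtain f where "\<forall>A\<in>?\<A>. witness A (f A)"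
    using bchoice[of ?\<A> witness] by auto
  then have f: "\<And>A. A \<in> ?\<A> \<Longrightarrow> f A \<in> poly_funs I" "\<And>A. A \<in> ?\<A> \<Longrightarrow> f A \<theta>\<^sub>0 \<noteq> 0"
    "\<And>A \<theta>. A \<in> ?\<A> \<Longrightarrow> f A \<theta> \<noteq> 0 \<Longrightarrow> indep_family (joint_row k S (full_cond k \<theta>)) A"
    by (simp_all add: witness_def)
  show ?thesis
  proof (intro bexI conjI allI impI)
    show "(\<lambda>\<theta>. \<Prod>A\<in>?\<A>. f A \<theta>) \<in> poly_funs I" by (rule poly_funs_prod) (rule f(1))
    show "(\<Prod>A\<in>?\<A>. f A \<theta>\<^sub>0) \<noteq> 0" using f(2) fin by (simp add: prod_zero_iff)
    fix \<theta> assume "(\<Prod>A\<in>?\<A>. f A \<theta>) \<noteq> 0"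
    then have "\<forall>A\<in>?\<A>. f A \<theta> \<noteq> 0" using fin by (simp add: prod_zero_iff)
    then show "kruskal_rank_ge m (joint_row k S (full_cond k \<theta>)) {1..r}"
      using f(3) by (simp add: kruskal_rank_ge_def)
  qed
qed

text \<open>A point of full Kruskal rank in every block. Up to the normalization, which rescales each joint row
  by a nonzero factor, the joint row of class \<open>i\<close> lists the powers of the number \<open>i\<close>, if \<open>w\<close> is a
  mixed radix system on the block. As the numbers of the classes are distinct, this is a Vandermonde
  matrix.\<close>

definition power_cond :: "(nat \<Rightarrow> nat) \<Rightarrow> (nat \<Rightarrow> nat) \<Rightarrow> cond_probs" where
  "power_cond k w i j l = real i ^ ((l - 1) * w j) / (\<Sum>t=1..k j. real i ^ ((t - 1) * w j))"

text \<open>A row scaled by \<open>1 / N i\<close> is independent exactly when the unscaled one is, so the relation is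
  tested with the coefficients \<open>c i / N i\<close>; \<open>N i\<close> is positive because the classes are numbered
  from \<open>1\<close>.\<close>

lemma power_cond_kruskal_rank:
  assumes S: "S \<subseteq> {1..p}" and k: "\<forall>j\<in>{1..p}. k j \<ge> 1" and w: "mixed_radix k S w"
  shows "kruskal_rank_ge (\<Prod>j\<in>S. k j) (joint_row k S (power_cond k w)) {1..r}"
  unfolding kruskal_rank_ge_def
proof (intro allI impI)
  fix A assume A: "A \<subseteq> {1..r}" "card A \<le> (\<Prod>j\<in>S. k j)"
  have finA: "finite A" using A finite_subset by blast
  define N where "N i = (\<Prod>j\<in>S. \<Sum>t=1..k j. real i ^ ((t - 1) * w j))" for i
  have N: "N i > 0" if "i \<in> A" for i
    unfolding N_def using that A S k
    by (intro prod_pos ballI sum_pos) (auto simp: subset_iff)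
  show "indep_family (joint_row k S (power_cond k w)) A"
    unfolding indep_family_def
  proof (intro allI impI ballI)
    fix c i assume c: "(\<Sum>i\<in>A. c i *\<^sub>R joint_row k S (power_cond k w) i) = 0" and i: "i \<in> A"
    have "c i / N i = 0"
    proof (rule vandermonde_indep[OF finA _ A(2) _ i])
      show "inj_on real A" by (simp add: inj_on_def)
      fix n assume "n < (\<Prod>j\<in>S. k j)"
      then obtain l where l: "l \<in> (\<Pi>\<^sub>E j\<in>S. {1..k j})" "(\<Sum>j\<in>S. (l j - 1) * w j) = n"
        using w unfolding mixed_radix_def by blast
      have "joint_row k S (power_cond k w) a l = real a ^ n / N a" for a
        using l(1) by (simp add: joint_row_def power_cond_def N_def prod_dividef power_sum l(2)[symmetric])
      then have "(\<Sum>a\<in>A. c a / N a * real a ^ n) = (\<Sum>a\<in>A. c a *\<^sub>R joint_row k S (power_cond k w) a) l"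
        by (simp add: sum_fun_apply)
      then show "(\<Sum>a\<in>A. c a / N a * real a ^ n) = 0" using c by simp
    qed
    then show "c i = 0" using N[OF i] by simp
  qed
qed

lemma kruskal_rank_joint_row_cong:
  assumes S: "S \<subseteq> {1..p}"
    and eq: "\<And>i j l. i \<in> {1..r} \<Longrightarrow> j \<in> {1..p} \<Longrightarrow> l \<in> {1..k j} \<Longrightarrow> q i j l = q' i j l"
  shows "kruskal_rank_ge m (joint_row k S q) {1..r} = kruskal_rank_ge m (joint_row k S q') {1..r}"
proof -
  have "joint_row k S q i = joint_row k S q' i" if i: "i \<in> {1..r}" for i
    by (rule joint_row_cong) (rule eq[OF i subsetD[OF S]])
  then have "indep_family (joint_row k S q) A = indep_family (joint_row k S q') A" if "A \<subseteq> {1..r}" for A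
    using that unfolding indep_family_def by (simp add: subset_iff cong: sum.cong)
  then show ?thesis by (simp add: kruskal_rank_ge_def)
qed

definition tripartition :: "nat set \<Rightarrow> nat set \<Rightarrow> nat set \<Rightarrow> nat \<Rightarrow> bool" where
  "tripartition S1 S2 S3 p \<longleftrightarrow> S1 \<union> S2 \<union> S3 = {1..p} \<and> S1 \<inter> S2 = {} \<and> S1 \<inter> S3 = {} \<and> S2 \<inter> S3 = {}"

text \<open>Glues index tuples of the three blocks. Off the first two blocks it follows \<open>c\<close>, so that it is
  \<open>undefined\<close> outside all blocks when \<open>c\<close> is extensional on the third block.\<close>

definition merge3 :: "nat set \<Rightarrow> nat set \<Rightarrow> (nat \<Rightarrow> 'a) \<Rightarrow> (nat \<Rightarrow> 'a) \<Rightarrow> (nat \<Rightarrow> 'a) \<Rightarrow> nat \<Rightarrow> 'a" where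
  "merge3 S1 S2 a b c j = (if j \<in> S1 then a j else if j \<in> S2 then b j else c j)"

text \<open>One polynomial serves the three blocks: as the blocks are disjoint, their place values combine
  into one \<open>w\<close>, and at the single point \<open>power_cond k w\<close> the polynomials of all blocks are nonzero,
  so their product is nonzero too.\<close>

lemma generic_kruskal_ranks:
  assumes k: "\<forall>j\<in>{1..p}. k j \<ge> 1" and I: "cond_coords r p k \<subseteq> I" and S: "tripartition S1 S2 S3 p"
  shows "\<exists>f\<in>poly_funs I. (\<exists>\<theta>\<in>I \<rightarrow>\<^sub>E UNIV. f \<theta> \<noteq> 0) \<and>
    (\<forall>\<pi>. \<forall>q\<in>cond_space r p k. f (coord_vec I (\<pi>, q)) \<noteq> 0 \<longrightarrow>
      (\<forall>S\<in>{S1, S2, S3}. kruskal_rank_ge (\<Prod>j\<in>S. k j) (joint_row k S q) {1..r}))"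
proof -
  let ?SS = "{S1, S2, S3}"
  have sub: "S \<subseteq> {1..p}" if "S \<in> ?SS" for S using S that by (auto simp: tripartition_def)
  have fin: "finite S" if "S \<in> ?SS" for S
    by (rule finite_subset[OF sub[OF that]]) simp
  obtain w1 w2 w3 where w123: "mixed_radix k S1 w1" "mixed_radix k S2 w2" "mixed_radix k S3 w3"
    using ex_mixed_radix[OF fin[of S1], of k] ex_mixed_radix[OF fin[of S2], of k]
      ex_mixed_radix[OF fin[of S3], of k] by auto
  define w where "w = merge3 S1 S2 w1 w2 w3"
  have w_eq: "w j = w1 j" if "j \<in> S1" for j using that by (simp add: w_def merge3_def)
  have w_eq2: "w j = w2 j" if "j \<in> S2" for j
    using that S by (auto simp: w_def merge3_def tripartition_def)
  have w_eq3: "w j = w3 j" if "j \<in> S3" for j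
    using that S by (auto simp: w_def merge3_def tripartition_def)
  have w: "mixed_radix k S w" if "S \<in> ?SS" for S
    using that w123 mixed_radix_cong[of S1 w w1 k, OF w_eq] mixed_radix_cong[of S2 w w2 k, OF w_eq2]
      mixed_radix_cong[of S3 w w3 k, OF w_eq3] by auto
  have cond: "(\<Sum>t=1..k j. power_cond k w i j t) = 1" if "i \<in> {1..r}" "j \<in> {1..p}" for i j
  proof -
    have "0 < (\<Sum>t=1..k j. real i ^ ((t - 1) * w j))"
      by (rule sum_pos) (use that k in auto)
    then show ?thesis by (simp add: power_cond_def sum_divide_distrib[symmetric])
  qed
  define \<theta>\<^sub>0 where "\<theta>\<^sub>0 = coord_vec I (\<lambda>_. 0, power_cond k w)"
  have full: "full_cond k \<theta>\<^sub>0 i j l = power_cond k w i j l"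
    if "i \<in> {1..r}" "j \<in> {1..p}" "l \<in> {1..k j}" for i j l
  proof (rule full_cond_eq)
    fix t assume "t \<in> {1..<k j}"
    then have "Cond i j t \<in> I" using I that by (auto simp: Cond_in_cond_coords)
    then show "\<theta>\<^sub>0 (Cond i j t) = power_cond k w i j t" by (simp add: \<theta>\<^sub>0_def coord_vec_def)
  qed (use that cond in auto)
  note row_cong = kruskal_rank_joint_row_cong[OF sub]
  define witness where "witness S f \<longleftrightarrow> f \<in> poly_funs I \<and> f \<theta>\<^sub>0 \<noteq> 0 \<and>
    (\<forall>\<theta>. f \<theta> \<noteq> 0 \<longrightarrow> kruskal_rank_ge (\<Prod>j\<in>S. k j) (joint_row k S (full_cond k \<theta>)) {1..r})" for S f
  have "\<exists>f. witness S f" if "S \<in> ?SS" for S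
    unfolding witness_def Bex_def[symmetric]
    by (rule kruskal_rank_open_condition[OF I sub[OF that]])
       (rule row_cong[OF that full, THEN iffD2, OF _ _ _ power_cond_kruskal_rank[OF sub[OF that] k w[OF that]]])
  then obtain f where "\<forall>S\<in>?SS. witness S (f S)"
    using bchoice[of ?SS witness] by auto
  then have f: "\<And>S. S \<in> ?SS \<Longrightarrow> f S \<in> poly_funs I" "\<And>S. S \<in> ?SS \<Longrightarrow> f S \<theta>\<^sub>0 \<noteq> 0"
    "\<And>S \<theta>. S \<in> ?SS \<Longrightarrow> f S \<theta> \<noteq> 0 \<Longrightarrow>
      kruskal_rank_ge (\<Prod>j\<in>S. k j) (joint_row k S (full_cond k \<theta>)) {1..r}"
    by (auto simp: witness_def)
  show ?thesis
  proof (intro bexI[of _ "\<lambda>\<theta>. \<Prod>S\<in>?SS. f S \<theta>"] conjI allI ballI impI)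
    show "(\<lambda>\<theta>. \<Prod>S\<in>?SS. f S \<theta>) \<in> poly_funs I" by (rule poly_funs_prod) (rule f(1))
    have "\<theta>\<^sub>0 \<in> I \<rightarrow>\<^sub>E UNIV" by (auto simp: \<theta>\<^sub>0_def coord_vec_def)
    moreover have "(\<Prod>S\<in>?SS. f S \<theta>\<^sub>0) \<noteq> 0" using f(2) by (subst prod_zero_iff) auto
    ultimately show "\<exists>\<theta>\<in>I \<rightarrow>\<^sub>E UNIV. (\<Prod>S\<in>?SS. f S \<theta>) \<noteq> 0" by blast
    fix \<pi> q S assume q: "q \<in> cond_space r p k" and "(\<Prod>S\<in>?SS. f S (coord_vec I (\<pi>, q))) \<noteq> 0" and S: "S \<in> ?SS"
    then have "f S (coord_vec I (\<pi>, q)) \<noteq> 0" by (subst (asm) prod_zero_iff) auto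
    from f(3)[OF S this] show "kruskal_rank_ge (\<Prod>j\<in>S. k j) (joint_row k S q) {1..r}"
      by (rule row_cong[OF S full_cond_coord_vec[OF I q], THEN iffD1, rotated -1])
  qed
qed

section \<open>Identifiability of the model\<close>

lemma sum_PiE_prod:
  fixes f :: "'a \<Rightarrow> 'b \<Rightarrow> real"
  assumes "finite S"
  shows "(\<Sum>l\<in>Pi\<^sub>E S B. \<Prod>j\<in>S. f j (l j)) = (\<Prod>j\<in>S. \<Sum>t\<in>B j. f j t)"
  using assms
proof (induction S rule: finite_induct)
  case empty
  show ?case by simp
next
  case (insert j S)
  have "(\<Sum>l\<in>Pi\<^sub>E (insert j S) B. \<Prod>i\<in>insert j S. f i (l i)) =
      (\<Sum>(t, l)\<in>B j \<times> Pi\<^sub>E S B. \<Prod>i\<in>insert j S. f i ((l(j := t)) i))"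
    unfolding PiE_insert_eq
    by (subst sum.reindex[OF inj_combinator[OF insert.hyps(2)]]) (simp add: case_prod_unfold)
  also have "\<dots> = (\<Sum>(t, l)\<in>B j \<times> Pi\<^sub>E S B. f j t * (\<Prod>i\<in>S. f i (l i)))"
  proof (intro sum.cong refl, clarsimp)
    fix t l
    have "(\<Prod>i\<in>S. f i (if i = j then t else l i)) = (\<Prod>i\<in>S. f i (l i))"
      by (rule prod.cong) (use insert.hyps in auto)
    then show "(\<Prod>i\<in>insert j S. f i (if i = j then t else l i)) = f j t * (\<Prod>i\<in>S. f i (l i))"
      using insert.hyps by simp
  qed
  also have "\<dots> = (\<Sum>t\<in>B j. f j t) * (\<Sum>l\<in>Pi\<^sub>E S B. \<Prod>i\<in>S. f i (l i))"
    by (simp add: sum.cartesian_product[symmetric] sum_product)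
  finally show ?case using insert by simp
qed

text \<open>The rank-one arrays of the classes determine the classes: summing over all entries gives the mixing
  weight, since each probability vector sums to one, and summing over all entries with a prescribed
  value of one feature gives the weight times the probability of that value.\<close>

lemma class_recovery:
  assumes q: "q \<in> cond_space r p k" "i \<in> {1..r}" and q': "q' \<in> cond_space r p k" "i' \<in> {1..r}"
    and c: "c \<noteq> 0"
    and eq: "\<And>l. l \<in> (\<Pi>\<^sub>E j\<in>{1..p}. {1..k j}) \<Longrightarrow>
      c * (\<Prod>j=1..p. q i j (l j)) = c' * (\<Prod>j=1..p. q' i' j (l j))"
  shows "c = c'" and "\<And>j l. j \<in> {1..p} \<Longrightarrow> l \<in> {1..k j} \<Longrightarrow> q i j l = q' i' j l"
proof -
  have marginal: "c * (\<Prod>j=1..p. \<Sum>t\<in>B j. q i j t) = c' * (\<Prod>j=1..p. \<Sum>t\<in>B j. q' i' j t)"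
    if "\<And>j. j \<in> {1..p} \<Longrightarrow> B j \<subseteq> {1..k j}" for B
  proof -
    have sub: "Pi\<^sub>E {1..p} B \<subseteq> (\<Pi>\<^sub>E j\<in>{1..p}. {1..k j})"
      by (rule PiE_mono) (use that in auto)
    have "(\<Sum>l\<in>Pi\<^sub>E {1..p} B. c * (\<Prod>j=1..p. q i j (l j))) =
        (\<Sum>l\<in>Pi\<^sub>E {1..p} B. c' * (\<Prod>j=1..p. q' i' j (l j)))"
      by (rule sum.cong) (use eq sub in auto)
    then show ?thesis by (simp add: sum_distrib_left[symmetric] sum_PiE_prod)
  qed
  have total: "(\<Sum>t=1..k j. q i j t) = 1" "(\<Sum>t=1..k j. q' i' j t) = 1" if "j \<in> {1..p}" for j
    using q q' that by (auto simp: cond_space_def)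
  show cc': "c = c'" using marginal[of "\<lambda>j. {1..k j}"] total by simp
  fix j l assume j: "j \<in> {1..p}" and l: "l \<in> {1..k j}"
  let ?B = "\<lambda>i. if i = j then {l} else {1..k i}"
  have single: "(\<Prod>m=1..p. \<Sum>t\<in>?B m. g m t) = g j l"
    if "\<And>m. m \<in> {1..p} \<Longrightarrow> (\<Sum>t=1..k m. g m t) = 1" for g :: "nat \<Rightarrow> nat \<Rightarrow> real"
  proof -
    have "(\<Prod>m=1..p. \<Sum>t\<in>?B m. g m t) = (\<Sum>t\<in>?B j. g j t) * (\<Prod>m\<in>{1..p} - {j}. \<Sum>t\<in>?B m. g m t)"
      using j by (subst prod.remove[of _ j]) auto
    also have "(\<Prod>m\<in>{1..p} - {j}. \<Sum>t\<in>?B m. g m t) = 1"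
      by (rule prod.neutral) (use that in auto)
    finally show ?thesis by simp
  qed
  have "c * q i j l = c' * q' i' j l"
    using marginal[of ?B] single[of "q i"] single[of "q' i'"] total l by auto
  then show "q i j l = q' i' j l" using c cc' by simp
qed

lemma joint_row_triple:
  assumes S: "tripartition S1 S2 S3 p"
  shows "joint_row k S1 q i a * joint_row k S2 q i b * joint_row k S3 q i c =
    (if a \<in> (\<Pi>\<^sub>E j\<in>S1. {1..k j}) \<and> b \<in> (\<Pi>\<^sub>E j\<in>S2. {1..k j}) \<and> c \<in> (\<Pi>\<^sub>E j\<in>S3. {1..k j})
     then \<Prod>j=1..p. q i j (merge3 S1 S2 a b c j) else 0)"
proof -
  have U: "{1..p} = (S1 \<union> S2) \<union> S3" and D: "(S1 \<union> S2) \<inter> S3 = {}" "S1 \<inter> S2 = {}"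
    using S by (auto simp: tripartition_def)
  have "finite ((S1 \<union> S2) \<union> S3)" unfolding U[symmetric] by simp
  then have fin: "finite (S1 \<union> S2)" "finite S1" "finite S2" "finite S3" by auto
  have "(\<Prod>j=1..p. q i j (merge3 S1 S2 a b c j)) =
      (\<Prod>j\<in>S1. q i j (merge3 S1 S2 a b c j)) * (\<Prod>j\<in>S2. q i j (merge3 S1 S2 a b c j)) *
      (\<Prod>j\<in>S3. q i j (merge3 S1 S2 a b c j))"
    unfolding U prod.union_disjoint[OF fin(1,4) D(1)] prod.union_disjoint[OF fin(2,3) D(2)] ..
  moreover have "(\<Prod>j\<in>S1. q i j (merge3 S1 S2 a b c j)) = (\<Prod>j\<in>S1. q i j (a j))"
    by (rule prod.cong) (auto simp: merge3_def)
  moreover have "(\<Prod>j\<in>S2. q i j (merge3 S1 S2 a b c j)) = (\<Prod>j\<in>S2. q i j (b j))"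
    by (rule prod.cong) (use D in \<open>auto simp: merge3_def\<close>)
  moreover have "(\<Prod>j\<in>S3. q i j (merge3 S1 S2 a b c j)) = (\<Prod>j\<in>S3. q i j (c j))"
    by (rule prod.cong) (use D in \<open>auto simp: merge3_def\<close>)
  ultimately show ?thesis by (simp add: joint_row_def)
qed

lemma merge3_PiE:
  assumes "tripartition S1 S2 S3 p"
    "a \<in> (\<Pi>\<^sub>E j\<in>S1. {1..k j})" "b \<in> (\<Pi>\<^sub>E j\<in>S2. {1..k j})" "c \<in> (\<Pi>\<^sub>E j\<in>S3. {1..k j})"
  shows "merge3 S1 S2 a b c \<in> (\<Pi>\<^sub>E j\<in>{1..p}. {1..k j})"
proof (rule PiE_I)
  fix j assume "j \<in> {1..p}"
  then consider "j \<in> S1" | "j \<notin> S1" "j \<in> S2" | "j \<notin> S1" "j \<notin> S2" "j \<in> S3"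
    using assms(1) unfolding tripartition_def by blast
  then show "merge3 S1 S2 a b c j \<in> {1..k j}"
    using PiE_mem[OF assms(2)] PiE_mem[OF assms(3)] PiE_mem[OF assms(4)]
    by cases (simp_all add: merge3_def)
next
  fix j assume "j \<notin> {1..p}"
  then have "j \<notin> S1" "j \<notin> S2" "j \<notin> S3" using assms(1) by (auto simp: tripartition_def)
  then show "merge3 S1 S2 a b c j = undefined" using PiE_arb[OF assms(4)] by (simp add: merge3_def)
qed

text \<open>Grouping the features by blocks turns the distribution into a three-way array that is a sum of
  \<open>r\<close> product arrays, with the mixing weight put into the first factor. Kruskal's theorem matches
  the product arrays of two parameters, and \<open>class_recovery\<close> reads off the classes.\<close>

lemma identifiable_if_kruskal_ranks:
  fixes k :: "nat \<Rightarrow> nat"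
  assumes S: "tripartition S1 S2 S3 p"
    and m: "1 \<le> m1" "1 \<le> m2" "1 \<le> m3" "m1 \<le> r" "m2 \<le> r" "m3 \<le> r" "2 * r + 2 \<le> m1 + m2 + m3"
    and kr: "kruskal_rank_ge m1 (joint_row k S1 q) {1..r}" "kruskal_rank_ge m2 (joint_row k S2 q) {1..r}"
      "kruskal_rank_ge m3 (joint_row k S3 q) {1..r}"
    and \<theta>: "(\<pi>, q) \<in> param_space r p k" and \<theta>': "(\<pi>', q') \<in> param_space r p k"
    and eq: "distr_array r p k (\<pi>', q') = distr_array r p k (\<pi>, q)"
  shows "eq_up_to_label_swapping r p k (\<pi>, q) (\<pi>', q')"
proof -
  have q: "q \<in> cond_space r p k" and q': "q' \<in> cond_space r p k"
    and \<pi>: "\<And>i. i \<in> {1..r} \<Longrightarrow> \<pi> i \<noteq> 0"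
    using \<theta> \<theta>' by (force simp: param_space_def mixing_props_def)+
  let ?L = "\<Pi>\<^sub>E j\<in>{1..p}. {1..k j}"
  have distr: "(\<Sum>i=1..r. \<pi> i * (\<Prod>j=1..p. q i j (l j))) = (\<Sum>i=1..r. \<pi>' i * (\<Prod>j=1..p. q' i j (l j)))"
    if "l \<in> ?L" for l
    using fun_cong[OF eq, of l] that by (simp add: distr_array_def)
  let ?x = "\<lambda>i. \<pi> i *\<^sub>R joint_row k S1 q i" and ?x' = "\<lambda>i. \<pi>' i *\<^sub>R joint_row k S1 q' i"
  have term_eq: "(\<pi> i *\<^sub>R joint_row k S1 q i) a * joint_row k S2 q i b * joint_row k S3 q i c =
      (if a \<in> (\<Pi>\<^sub>E j\<in>S1. {1..k j}) \<and> b \<in> (\<Pi>\<^sub>E j\<in>S2. {1..k j}) \<and> c \<in> (\<Pi>\<^sub>E j\<in>S3. {1..k j})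
       then \<pi> i * (\<Prod>j=1..p. q i j (merge3 S1 S2 a b c j)) else 0)" for \<pi> q i a b c
    using joint_row_triple[OF S, of k q i a b c] by (simp add: mult.assoc)
  have "\<exists>\<tau>. bij_betw \<tau> {1..r} {1..r} \<and> (\<forall>i\<in>{1..r}. \<forall>a b c.
      ?x i a * joint_row k S2 q i b * joint_row k S3 q i c =
      ?x' (\<tau> i) a * joint_row k S2 q' (\<tau> i) b * joint_row k S3 q' (\<tau> i) c)"
  proof (rule kruskal_uniqueness)
    show "kruskal_rank_ge m1 ?x {1..r}" using kr(1) \<pi> by (rule kruskal_rank_ge_scale)
    \<comment> \<open>If at most one of the three ranks is at least \<open>n\<close>, lowering \<open>r\<close> to \<open>n\<close> costs at most \<open>r - n\<close> on
      the right. Otherwise two terms on the right are \<open>n\<close>, and the third is at least \<open>2\<close>, as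
      \<open>m1\<close>, \<open>m2\<close>, \<open>m3\<close> are at most \<open>r\<close>.\<close>
    show "2 * n + 2 \<le> min m1 n + min m2 n + min m3 n" if "2 \<le> n" "n \<le> card {1..r}" for n
      using m that by (auto simp: min_def)
    show "(\<Sum>i=1..r. ?x i a * joint_row k S2 q i b * joint_row k S3 q i c) =
        (\<Sum>i=1..r. ?x' i a * joint_row k S2 q' i b * joint_row k S3 q' i c)" for a b c
    proof (cases "a \<in> (\<Pi>\<^sub>E j\<in>S1. {1..k j}) \<and> b \<in> (\<Pi>\<^sub>E j\<in>S2. {1..k j}) \<and> c \<in> (\<Pi>\<^sub>E j\<in>S3. {1..k j})")
      case True
      then have "merge3 S1 S2 a b c \<in> ?L" using merge3_PiE[OF S] by blast
      from distr[OF this] show ?thesis unfolding term_eq if_P[OF True] .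
    next
      case False
      show ?thesis unfolding term_eq if_not_P[OF False] by simp
    qed
  qed (use kr m in auto)
  then obtain \<tau> where \<tau>: "bij_betw \<tau> {1..r} {1..r}" and
    terms: "\<And>i a b c. i \<in> {1..r} \<Longrightarrow> ?x i a * joint_row k S2 q i b * joint_row k S3 q i c =
      ?x' (\<tau> i) a * joint_row k S2 q' (\<tau> i) b * joint_row k S3 q' (\<tau> i) c" by blast
  have class_eq: "\<pi> i * (\<Prod>j=1..p. q i j (l j)) = \<pi>' (\<tau> i) * (\<Prod>j=1..p. q' (\<tau> i) j (l j))"
    if i: "i \<in> {1..r}" and l: "l \<in> ?L" for i l
  proof -
    have sub: "S1 \<subseteq> {1..p}" "S2 \<subseteq> {1..p}" "S3 \<subseteq> {1..p}" using S by (auto simp: tripartition_def)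
    have "(\<Prod>j=1..p. g j (merge3 S1 S2 (restrict l S1) (restrict l S2) (restrict l S3) j)) =
        (\<Prod>j=1..p. g j (l j))" for g :: "nat \<Rightarrow> nat \<Rightarrow> real"
      by (rule prod.cong) (use S in \<open>auto simp: tripartition_def merge3_def\<close>)
    moreover have "restrict l T \<in> (\<Pi>\<^sub>E j\<in>T. {1..k j})" if "T \<subseteq> {1..p}" for T
      using that PiE_mem[OF l] unfolding restrict_PiE_iff by blast
    then have "restrict l S1 \<in> (\<Pi>\<^sub>E j\<in>S1. {1..k j}) \<and> restrict l S2 \<in> (\<Pi>\<^sub>E j\<in>S2. {1..k j}) \<and>
        restrict l S3 \<in> (\<Pi>\<^sub>E j\<in>S3. {1..k j})" using sub by blast
    ultimately show ?thesis
      using terms[OF i, of "restrict l S1" "restrict l S2" "restrict l S3"]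
      unfolding term_eq by (simp only: if_True simp_thms)
  qed
  have \<tau>_in: "\<tau> i \<in> {1..r}" if "i \<in> {1..r}" for i using \<tau> that by (auto simp: bij_betw_def)
  have recover: "\<pi> i = \<pi>' (\<tau> i)" "\<And>j l. j \<in> {1..p} \<Longrightarrow> l \<in> {1..k j} \<Longrightarrow> q i j l = q' (\<tau> i) j l"
    if i: "i \<in> {1..r}" for i
    using class_recovery[OF q i q' \<tau>_in[OF i] \<pi>[OF i] class_eq[OF i]] by blast+
  define \<sigma> where "\<sigma> i = (if i \<in> {1..r} then the_inv_into {1..r} \<tau> i else i)" for i
  have "bij_betw \<sigma> {1..r} {1..r}"
    using bij_betw_the_inv_into[OF \<tau>] by (rule bij_betw_cong[THEN iffD1, rotated]) (simp add: \<sigma>_def)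
  then have perm: "\<sigma> permutes {1..r}" by (rule bij_imp_permutes) (auto simp: \<sigma>_def)
  have "\<pi>' i = \<pi> (\<sigma> i) \<and> (\<forall>j\<in>{1..p}. \<forall>l\<in>{1..k j}. q' i j l = q (\<sigma> i) j l)"
    if i: "i \<in> {1..r}" for i
  proof -
    have "\<tau> (\<sigma> i) = i" using f_the_inv_into_f_bij_betw[OF \<tau>] i by (simp add: \<sigma>_def)
    moreover have "\<sigma> i \<in> {1..r}" using i permutes_in_image[OF perm] by blast
    ultimately show ?thesis using recover[of "\<sigma> i"] by simp
  qed
  then show ?thesis using perm by (auto simp: eq_up_to_label_swapping_def)
qed

lemma proper_subvariety_hypersurface:
  assumes "f \<in> poly_funs I" "\<exists>\<theta>\<in>I \<rightarrow>\<^sub>E UNIV. f \<theta> \<noteq> 0"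
  shows "proper_subvariety I {\<theta> \<in> I \<rightarrow>\<^sub>E UNIV. f \<theta> = 0}"
  unfolding proper_subvariety_def by (rule exI[of _ "{f}"]) (use assms in auto)

text \<open>The exceptional set involves only the conditional probabilities, and \<open>\<pi>\<close> is quantified inside.
  Hence one statement covers the full model and the submodels with fixed mixing proportions, with
  \<open>I\<close> the respective coordinate set.\<close>

lemma generic_identifiability:
  assumes k: "\<forall>j\<in>{1..p}. k j \<ge> 1" and I: "cond_coords r p k \<subseteq> I" and S: "tripartition S1 S2 S3 p"
    and m: "min r (\<Prod>j\<in>S1. k j) + min r (\<Prod>j\<in>S2. k j) + min r (\<Prod>j\<in>S3. k j) \<ge> 2 * r + 2"
  shows "\<exists>V. proper_subvariety I V \<and>
    (\<forall>\<pi> q \<pi>' q'. (\<pi>, q) \<in> param_space r p k \<longrightarrow> coord_vec I (\<pi>, q) \<notin> V \<longrightarrow>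
      (\<pi>', q') \<in> param_space r p k \<longrightarrow> distr_array r p k (\<pi>', q') = distr_array r p k (\<pi>, q) \<longrightarrow>
      eq_up_to_label_swapping r p k (\<pi>, q) (\<pi>', q'))"
proof -
  obtain f where f: "f \<in> poly_funs I" "\<exists>\<theta>\<in>I \<rightarrow>\<^sub>E UNIV. f \<theta> \<noteq> 0"
    and kr: "\<And>\<pi> q S. q \<in> cond_space r p k \<Longrightarrow> f (coord_vec I (\<pi>, q)) \<noteq> 0 \<Longrightarrow> S \<in> {S1, S2, S3} \<Longrightarrow>
      kruskal_rank_ge (\<Prod>j\<in>S. k j) (joint_row k S q) {1..r}"
    using generic_kruskal_ranks[OF k I S] by blast
  have ranks: "1 \<le> min r (\<Prod>j\<in>S1. k j)" "1 \<le> min r (\<Prod>j\<in>S2. k j)" "1 \<le> min r (\<Prod>j\<in>S3. k j)"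
    using m by linarith+
  let ?V = "{\<theta> \<in> I \<rightarrow>\<^sub>E UNIV. f \<theta> = 0}"
  show ?thesis
  proof (intro exI[of _ ?V] conjI allI impI)
    show "proper_subvariety I ?V" using f by (rule proper_subvariety_hypersurface)
    fix \<pi> q \<pi>' q'
    assume \<theta>: "(\<pi>, q) \<in> param_space r p k" and gen: "coord_vec I (\<pi>, q) \<notin> ?V"
      and \<theta>': "(\<pi>', q') \<in> param_space r p k"
      and eq: "distr_array r p k (\<pi>', q') = distr_array r p k (\<pi>, q)"
    have "coord_vec I (\<pi>, q) \<in> I \<rightarrow>\<^sub>E UNIV" by (auto simp: coord_vec_def)
    then have nz: "f (coord_vec I (\<pi>, q)) \<noteq> 0" using gen by blast
    have q: "q \<in> cond_space r p k" using \<theta> by (simp add: param_space_def)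
    note kr' = kruskal_rank_ge_le[OF kr[OF q nz] min.cobounded2]
    show "eq_up_to_label_swapping r p k (\<pi>, q) (\<pi>', q')"
      by (rule identifiable_if_kruskal_ranks[OF S ranks _ _ _ m kr' kr' kr' \<theta> \<theta>' eq]) auto
  qed
qed

theorem theorem4:
  fixes p r :: nat and k :: "nat \<Rightarrow> nat"
  assumes "p \<ge> 3" and "r \<ge> 1" and "\<forall>j\<in>{1..p}. k j \<ge> 1"
    and "\<exists>S1 S2 S3. S1 \<union> S2 \<union> S3 = {1..p} \<and>
           S1 \<inter> S2 = {} \<and> S1 \<inter> S3 = {} \<and> S2 \<inter> S3 = {} \<and>
           S1 \<noteq> {} \<and> S2 \<noteq> {} \<and> S3 \<noteq> {} \<and>
           min r (\<Prod>j\<in>S1. k j) + min r (\<Prod>j\<in>S2. k j) + min r (\<Prod>j\<in>S3. k j) \<ge> 2 * r + 2"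
  shows "gen_ident_model r p k \<and> (\<forall>\<pi>\<in>mixing_props r. gen_ident_fixed_mixing r p k \<pi>)"
proof -
  obtain S1 S2 S3 where S: "tripartition S1 S2 S3 p"
    and m: "min r (\<Prod>j\<in>S1. k j) + min r (\<Prod>j\<in>S2. k j) + min r (\<Prod>j\<in>S3. k j) \<ge> 2 * r + 2"
    using assms(4) by (auto simp: tripartition_def)
  note generic = generic_identifiability[OF assms(3) _ S m]
  have "cond_coords r p k \<subseteq> all_coords r p k" by (simp add: all_coords_def)
  from generic[OF this] have "gen_ident_model r p k"
    unfolding gen_ident_model_def generically_identifiable_def by fast
  moreover have "gen_ident_fixed_mixing r p k \<pi>" if "\<pi> \<in> mixing_props r" for \<pi>
  proof -
    have "(\<pi>, q) \<in> param_space r p k \<longleftrightarrow> q \<in> cond_space r p k" for q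
      using that by (simp add: param_space_def)
    then show ?thesis
      using generic[OF order_refl] unfolding gen_ident_fixed_mixing_def generically_identifiable_def by fast
  qed
  ultimately show ?thesis by blast
qed

end
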